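(* Let $D=(V,A)$ be a digraph with no isolated nodes, $k\ge 2$ an integer, and $w:V\to\{0,1,2,\dots\}$ an integer-valued weight function. Let $\mathcal C_D$ denote the set of circuits of $D$. Then $$\max\Big\{\sum_{v\in S}w(v) : S\subseteq V \text{ a } k\text{-sink-stable set}\Big\} = \min_{y:\mathcal C_D\to \mathbf Z_+}\Big\{k\sum_{C\in\mathcal C_D}y(C)\eta(C)+\sum_{v\in V}\Big(w(v)-\sum_{C\in\mathcal C_D,\ v\in V(C)}y(C)\Big)^+\Big\}.$$ More concisely, the linear system $\{Qx\le k\eta,\ 0\le x\le \mathbf 1\}$ is totally dual integral, where $Q$ is the circuit versus node incidence matrix of $D$, $\eta$ is the vector whose component corresponding to a circuit $C$ is $\eta(C)$, and $\mathbf 1$ is the all-ones vector in $\mathbf R^V$.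
   Context: Digraphs are finite; parallel and oppositely directed edges are allowed. $\mathbf Z_+$ is the set of non-negative integers and $x^+=\max\{x,0\}$. A directed cut (dicut) of a digraph is the set of edges entering a subset $Z$ of nodes, provided no edge leaves $Z$. A sink node is a node with no leaving edge; a sink set is a set of nodes each of which is a sink. A set of nodes is sink-stable in $D$ if there are pairwise edge-disjoint dicuts of $D$ such that, after reversing the orientation of all edges of these dicuts, the set becomes a sink set. A set of nodes is $k$-sink-stable if it can be partitioned into $k$ sink-stable sets (possibly empty). A circuit $C$ of $D$ is a subdigraph whose underlying undirected graph is a circuit (connected with every degree equal to 2; its edges may be oriented arbitrarily, and two edges joining the same two nodes form a circuit); $V(C)$ is its node-set. Traversing $C$ in one of its two directions, each edge is forward or backward according to whether it is traversed along or against its orientation; $\eta(C)$ is the minimum of the number of forward edges and the number of backward edges of $C$. The matrix $Q$ is the $(0,1)$-matrix with rows indexed by circuits and columns by nodes, whose $(C,v)$ entry is $1$ exactly when $v\in V(C)$. A linear system is totally dual integral if, for every integral objective vector for which the (primal) maximum is finite, the dual linear program has an integral optimal solution. *)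

theory Defs
  imports Complex_Main "Graph_Theory.Graph_Theory"
begin

text \<open>
  Digraphs are the finite well-formed digraphs (locale \<open>fin_digraph\<close>) of the \<open>Graph_Theory\<close>
  library: parallel and oppositely directed arcs are allowed. Loops are not excluded either; a loop
  is an arc leaving its node and, contributing 2 to the degree, forms a circuit.
\<close>

definition no_isolated_nodes :: "('a,'b) pre_digraph \<Rightarrow> bool" where
  "no_isolated_nodes D \<longleftrightarrow> (\<forall>v\<in>verts D. in_arcs D v \<union> out_arcs D v \<noteq> {})"


subsection \<open>Sink-stable sets\<close>

definition dicut :: "('a,'b) pre_digraph \<Rightarrow> 'b set \<Rightarrow> bool" where
  "dicut D F \<longleftrightarrow> (\<exists>Z\<subseteq>verts D.
     (\<forall>e\<in>arcs D. \<not> (tail D e \<in> Z \<and> head D e \<notin> Z)) \<and>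
     F = {e \<in> arcs D. tail D e \<notin> Z \<and> head D e \<in> Z})"

definition reverse_arcs :: "'b set \<Rightarrow> ('a,'b) pre_digraph \<Rightarrow> ('a,'b) pre_digraph" where
  "reverse_arcs F D = \<lparr> verts = verts D, arcs = arcs D,
     tail = (\<lambda>e. if e \<in> F then head D e else tail D e),
     head = (\<lambda>e. if e \<in> F then tail D e else head D e) \<rparr>"

definition sink_node :: "('a,'b) pre_digraph \<Rightarrow> 'a \<Rightarrow> bool" where
  "sink_node D v \<longleftrightarrow> v \<in> verts D \<and> out_arcs D v = {}"

definition sink_set :: "('a,'b) pre_digraph \<Rightarrow> 'a set \<Rightarrow> bool" where
  "sink_set D S \<longleftrightarrow> (\<forall>v\<in>S. sink_node D v)"

definition sink_stable :: "('a,'b) pre_digraph \<Rightarrow> 'a set \<Rightarrow> bool" where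
  "sink_stable D S \<longleftrightarrow> (\<exists>\<F>. (\<forall>F\<in>\<F>. dicut D F) \<and> pairwise disjnt \<F> \<and>
     sink_set (reverse_arcs (\<Union>\<F>) D) S)"

definition k_sink_stable :: "('a,'b) pre_digraph \<Rightarrow> nat \<Rightarrow> 'a set \<Rightarrow> bool" where
  "k_sink_stable D k S \<longleftrightarrow> (\<exists>P :: nat \<Rightarrow> 'a set.
     (\<forall>i<k. sink_stable D (P i)) \<and>
     (\<forall>i<k. \<forall>j<k. i \<noteq> j \<longrightarrow> P i \<inter> P j = {}) \<and>
     S = (\<Union>i<k. P i))"


subsection \<open>Circuits\<close>

definition circuit :: "('a,'b) pre_digraph \<Rightarrow> bool" where
  "circuit C \<longleftrightarrow> Digraph_Component.connected C \<and> (\<forall>v\<in>verts C. in_degree C v + out_degree C v = 2)"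

definition circuits :: "('a,'b) pre_digraph \<Rightarrow> ('a,'b) pre_digraph set" where
  "circuits D = {C. subgraph C D \<and> circuit C}"

text \<open>
  A step along an arc is a pair of the arc and a flag telling whether it is traversed forward
  (from tail to head) or backward.
\<close>

definition both_ways :: "('a,'b) pre_digraph \<Rightarrow> ('a, 'b \<times> bool) pre_digraph" where
  "both_ways C = \<lparr> verts = verts C, arcs = arcs C \<times> UNIV,
     tail = (\<lambda>(e, fwd). if fwd then tail C e else head C e),
     head = (\<lambda>(e, fwd). if fwd then head C e else tail C e) \<rparr>"

definition traversal :: "('a,'b) pre_digraph \<Rightarrow> ('b \<times> bool) list \<Rightarrow> bool" where
  "traversal C p \<longleftrightarrow> pre_digraph.cycle (both_ways C) p \<and>
     distinct (map fst p) \<and> set (map fst p) = arcs C"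

definition forward_count :: "('b \<times> bool) list \<Rightarrow> nat" where
  "forward_count p = length (filter snd p)"

definition backward_count :: "('b \<times> bool) list \<Rightarrow> nat" where
  "backward_count p = length (filter (\<lambda>s. \<not> snd s) p)"

text \<open>
  Traversals of a circuit differ only in the starting node and the direction; reversing the
  direction swaps the two counts, so the minimum does not depend on the chosen traversal.
\<close>

definition eta :: "('a,'b) pre_digraph \<Rightarrow> nat" where
  "eta C = (let p = (SOME p. traversal C p) in min (forward_count p) (backward_count p))"


subsection \<open>The two sides of the min-max formula\<close>

definition is_maximum :: "int set \<Rightarrow> int \<Rightarrow> bool" where
  "is_maximum A m \<longleftrightarrow> m \<in> A \<and> (\<forall>a\<in>A. a \<le> m)"

definition is_minimum :: "int set \<Rightarrow> int \<Rightarrow> bool" where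
  "is_minimum A m \<longleftrightarrow> m \<in> A \<and> (\<forall>a\<in>A. m \<le> a)"

definition stable_weights :: "('a,'b) pre_digraph \<Rightarrow> nat \<Rightarrow> ('a \<Rightarrow> nat) \<Rightarrow> int set" where
  "stable_weights D k w =
     {(\<Sum>v\<in>S. int (w v)) | S. S \<subseteq> verts D \<and> k_sink_stable D k S}"

definition circuit_cost ::
  "('a,'b) pre_digraph \<Rightarrow> nat \<Rightarrow> ('a \<Rightarrow> nat) \<Rightarrow> (('a,'b) pre_digraph \<Rightarrow> nat) \<Rightarrow> int" where
  "circuit_cost D k w y =
     int k * (\<Sum>C\<in>circuits D. int (y C) * int (eta C)) +
     (\<Sum>v\<in>verts D. max (int (w v) - (\<Sum>C\<in>{C \<in> circuits D. v \<in> verts C}. int (y C))) 0)"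


subsection \<open>Total dual integrality\<close>

text \<open>
  The linear system \<open>(\<Sum>j\<in>J. M i j * x j) \<le> b i\<close> for \<open>i \<in> I\<close>, with finite row set \<open>I\<close> and
  column set \<open>J\<close>. Its variables are unrestricted in sign, so the dual constraints on the columns
  are equations.
\<close>

definition primal_feasible ::
  "'i set \<Rightarrow> 'j set \<Rightarrow> ('i \<Rightarrow> 'j \<Rightarrow> real) \<Rightarrow> ('i \<Rightarrow> real) \<Rightarrow> ('j \<Rightarrow> real) set" where
  "primal_feasible I J M b = {x. \<forall>i\<in>I. (\<Sum>j\<in>J. M i j * x j) \<le> b i}"

definition dual_feasible ::
  "'i set \<Rightarrow> 'j set \<Rightarrow> ('i \<Rightarrow> 'j \<Rightarrow> real) \<Rightarrow> ('j \<Rightarrow> real) \<Rightarrow> ('i \<Rightarrow> real) set" where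
  "dual_feasible I J M c =
     {y. (\<forall>i\<in>I. 0 \<le> y i) \<and> (\<forall>j\<in>J. (\<Sum>i\<in>I. y i * M i j) = c j)}"

definition totally_dual_integral ::
  "'i set \<Rightarrow> 'j set \<Rightarrow> ('i \<Rightarrow> 'j \<Rightarrow> real) \<Rightarrow> ('i \<Rightarrow> real) \<Rightarrow> bool" where
  "totally_dual_integral I J M b \<longleftrightarrow>
     (\<forall>c :: 'j \<Rightarrow> int.
        primal_feasible I J M b \<noteq> {} \<and>
        bdd_above ((\<lambda>x. \<Sum>j\<in>J. of_int (c j) * x j) ` primal_feasible I J M b) \<longrightarrow>
        (\<exists>y \<in> dual_feasible I J M (\<lambda>j. of_int (c j)).
           (\<forall>i\<in>I. y i \<in> \<int>) \<and>
           (\<forall>y' \<in> dual_feasible I J M (\<lambda>j. of_int (c j)).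
              (\<Sum>i\<in>I. y i * b i) \<le> (\<Sum>i\<in>I. y' i * b i))))"

text \<open>
  The system \<open>Q x \<le> k \<eta>\<close>, \<open>0 \<le> x \<le> 1\<close>: one row for each circuit, and for each node \<open>v\<close> the
  rows \<open>x v \<le> 1\<close> and \<open>- x v \<le> 0\<close>.
\<close>

definition incidence_Q :: "('a,'b) pre_digraph \<Rightarrow> 'a \<Rightarrow> real" where
  "incidence_Q C v = (if v \<in> verts C then 1 else 0)"

datatype ('a,'b) row = Circuit_Row "('a,'b) pre_digraph" | Upper_Row 'a | Lower_Row 'a

definition system_rows :: "('a,'b) pre_digraph \<Rightarrow> ('a,'b) row set" where
  "system_rows D = Circuit_Row ` circuits D \<union> Upper_Row ` verts D \<union> Lower_Row ` verts D"

fun system_matrix :: "('a,'b) row \<Rightarrow> 'a \<Rightarrow> real" where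
  "system_matrix (Circuit_Row C) v = incidence_Q C v"
| "system_matrix (Upper_Row u) v = (if u = v then 1 else 0)"
| "system_matrix (Lower_Row u) v = (if u = v then - 1 else 0)"

fun system_rhs :: "nat \<Rightarrow> ('a,'b) row \<Rightarrow> real" where
  "system_rhs k (Circuit_Row C) = real k * real (eta C)"
| "system_rhs k (Upper_Row u) = 1"
| "system_rhs k (Lower_Row u) = 0"

end

theory Submission
  imports Defs
begin

text \<open>
  Both sides of the formula are read off one minimum cost flow.

  Reversing disjoint dicuts is the same as choosing an integral potential \<open>\<pi>\<close> that grows by 0 or 1
  along every arc, and \<open>S\<close> becomes a sink set iff \<open>\<pi>\<close> grows along the arcs whose tail lies in \<open>S\<close>
  and stays constant along those whose head lies in \<open>S\<close> (\<open>sink_stable_iff_potential\<close>). Summing these inequalities around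
  a circuit gives \<open>card (S \<inter> verts C) \<le> eta C\<close>, which yields weak duality. Conversely, a
  potential with \<open>\<pi> u + [u \<in> S] \<le> \<pi> v\<close> and \<open>\<pi> v + [v \<in> S] \<le> \<pi> u + k\<close> for every arc from \<open>u\<close> to \<open>v\<close>
  makes \<open>S\<close> \<open>k\<close>-sink-stable: the residues of \<open>\<pi>\<close> modulo \<open>k\<close> split \<open>S\<close> into \<open>k\<close> sink-stable parts
  (\<open>k_sink_stableI_potential\<close>).

  Such a potential is the dual solution of a flow problem. Send \<open>w v\<close> units through each node \<open>v\<close>,
  either directly at cost 1 per unit, or by closed walks that traverse arcs forward at cost \<open>k\<close> and
  backward for free. An integral flow of minimum cost leaves no negative cycle in its residual digraph,
  so it comes with an integral potential satisfying complementary slackness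
  (\<open>min_cost_flow_potential\<close>), and this potential provides \<open>\<pi>\<close> and a set \<open>S\<close> whose weight is the cost of
  the flow (\<open>optimal_circulation\<close>). The flow itself decomposes into simple cycles. Each of them is either
  a traversal of a circuit \<open>C\<close>, of cost at least \<open>k * eta C\<close>, or goes back and forth along one arc; the
  latter costs \<open>k\<close> and serves two nodes, and since \<open>k \<ge> 2\<close> these are served directly at no higher cost.
  So the flow yields circuit multiplicities \<open>y\<close> whose cost is at most the weight of \<open>S\<close>
  (\<open>circulation_to_circuits\<close>), and all inequalities are equalities.

  The function \<open>eta\<close> evaluates an arbitrary traversal. That every circuit has a traversal, and that all
  traversals give the same value, are \<open>circuit_has_traversal\<close> and \<open>eta_eq_min_counts\<close>.
\<close>

section \<open>Simple cycles\<close>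

lemma (in pre_digraph) cas_iff_map: "cas u p v \<longleftrightarrow> u # map (head G) p = map (tail G) p @ [v]"
  by (induction u p v rule: cas.induct) auto

lemma (in pre_digraph) awalk_verts_eq_map: "cas u p v \<Longrightarrow> awalk_verts u p = u # map (head G) p"
  by (induction u p v rule: cas.induct) auto

text \<open>The heads along a closed walk are its tails shifted by one place. In this form sums over heads and
  over tails can be compared, and no starting node has to be carried along.\<close>

lemma (in wf_digraph) cycle_iff_rotate:
  "cycle p \<longleftrightarrow> p \<noteq> [] \<and> set p \<subseteq> arcs G \<and>
     map (head G) p = rotate1 (map (tail G) p) \<and> distinct (map (tail G) p)"
proof (cases p)
  case (Cons e es)
  have "(\<exists>u. u \<in> verts G \<and> set p \<subseteq> arcs G \<and> cas u p u \<and> distinct (map (head G) p)) \<longleftrightarrow>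
     set p \<subseteq> arcs G \<and> map (head G) p = rotate1 (map (tail G) p) \<and> distinct (map (head G) p)"
    by (auto simp: cas_iff_map Cons)
  moreover have "cycle p \<longleftrightarrow> (\<exists>u. u \<in> verts G \<and> set p \<subseteq> arcs G \<and> cas u p u \<and> distinct (map (head G) p))"
    unfolding cycle_def awalk_def using awalk_verts_eq_map by (metis Cons list.distinct(1) list.sel(3))
  ultimately show ?thesis
    by (metis Cons distinct1_rotate list.distinct(1))
qed (simp add: cycle_def)

lemma (in wf_digraph) cycle_nth_head:
  assumes "cycle p" "i < length p"
  shows "head G (p ! i) = tail G (p ! (Suc i mod length p))"
proof -
  have "head G (p ! i) = map (head G) p ! i" using assms(2) by simp
  also have "\<dots> = rotate1 (map (tail G) p) ! i"
    using assms(1) by (simp only: cycle_iff_rotate)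
  also have "\<dots> = tail G (p ! (Suc i mod length p))"
    using assms(2) by (subst nth_rotate1) (auto intro!: nth_map mod_less_divisor)
  finally show ?thesis .
qed

lemma (in wf_digraph) cycle_distinct: "cycle p \<Longrightarrow> distinct p"
  using cycle_iff_rotate distinct_map by blast

lemma (in wf_digraph) cycle_inj_on_tail: "cycle p \<Longrightarrow> inj_on (tail G) (set p)"
  by (simp add: cycle_iff_rotate distinct_map)

lemma (in wf_digraph) cycle_inj_on_head: "cycle p \<Longrightarrow> inj_on (head G) (set p)"
  by (metis cycle_iff_rotate distinct1_rotate distinct_map)

lemma (in wf_digraph) cycle_head_image: "cycle p \<Longrightarrow> head G ` set p = tail G ` set p"
  by (metis cycle_iff_rotate list.set_map set_rotate1)

lemma (in wf_digraph) cycle_sum_head_eq_tail: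
  fixes \<phi> :: "'a \<Rightarrow> 'c::comm_monoid_add"
  assumes "cycle p"
  shows "(\<Sum>e\<in>set p. \<phi> (head G e)) = (\<Sum>e\<in>set p. \<phi> (tail G e))"
  using sum.reindex[OF cycle_inj_on_head[OF assms], of \<phi>]
    sum.reindex[OF cycle_inj_on_tail[OF assms], of \<phi>] cycle_head_image[OF assms]
  by (simp add: o_def)

text \<open>Induction along a cycle; it serves to compare two traversals of a circuit step by step and to
  see that the nodes of a cycle are connected.\<close>

lemma (in wf_digraph) cycle_propagate:
  assumes cyc: "cycle p" and e: "e \<in> set p" "P e"
    and step: "\<And>e e'. \<lbrakk>e \<in> set p; e' \<in> set p; tail G e' = head G e; P e\<rbrakk> \<Longrightarrow> P e'"
    and f: "f \<in> set p"
  shows "P f"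
proof -
  let ?n = "length p"
  obtain i where i: "i < ?n" "p ! i = e" using e by (meson in_set_conv_nth)
  obtain j where j: "j < ?n" "p ! j = f" using f by (meson in_set_conv_nth)
  have n: "?n > 0" using i(1) by linarith
  have "P (p ! ((i + m) mod ?n))" for m
  proof (induction m)
    case 0
    then show ?case using i e by simp
  next
    case (Suc m)
    have lt: "(i + m) mod ?n < ?n" "(i + Suc m) mod ?n < ?n" using n by simp_all
    have "tail G (p ! ((i + Suc m) mod ?n)) = head G (p ! ((i + m) mod ?n))"
      using cycle_nth_head[OF cyc lt(1)] by (simp add: mod_Suc_eq)
    then show ?case using Suc.IH step nth_mem lt by blast
  qed
  from this[of "?n - i + j"] show ?thesis using i j by simp
qed

text \<open>Following successors from any arc of a finite set must come back to a node seen before; the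
  stretch between the two visits at the first such return is a simple cycle. The relation \<open>ok\<close>
  restricts which successors may be followed: it will forbid going back along the arc just used.\<close>

lemma (in fin_digraph) cycle_from_successors:
  assumes R: "R \<subseteq> arcs G" "R \<noteq> {}"
    and succ: "\<And>e. e \<in> R \<Longrightarrow> \<exists>e'\<in>R. tail G e' = head G e \<and> ok e e'"
  obtains p where "cycle p" "set p \<subseteq> R" "\<And>i. Suc i < length p \<Longrightarrow> ok (p ! i) (p ! Suc i)"
proof -
  obtain nxt where nxt: "\<And>e. e \<in> R \<Longrightarrow> nxt e \<in> R \<and> tail G (nxt e) = head G e \<and> ok e (nxt e)"
    using succ by metis
  obtain e0 where e0: "e0 \<in> R" using R by blast
  define x where "x i = (nxt ^^ i) e0" for i
  have xR: "x i \<in> R" for i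
    by (induction i) (auto simp: x_def e0 nxt)
  have xS: "tail G (x (Suc i)) = head G (x i)" "ok (x i) (x (Suc i))" for i
    using nxt[OF xR[of i]] by (auto simp: x_def)
  have "finite (range (\<lambda>i. tail G (x i)))"
    by (rule finite_subset[OF _ finite_verts]) (use R(1) xR tail_in_verts in blast)
  then have "\<not> inj (\<lambda>i. tail G (x i))"
    using finite_imageD infinite_UNIV_nat by blast
  then obtain a b where "a < b" "tail G (x a) = tail G (x b)"
    unfolding inj_on_def by (metis linorder_neqE_nat)
  define j where "j = (LEAST j. \<exists>i<j. tail G (x i) = tail G (x j))"
  have ex: "\<exists>j. \<exists>i<j. tail G (x i) = tail G (x j)"
    using \<open>a < b\<close> \<open>tail G (x a) = tail G (x b)\<close> by blast
  obtain i where i: "i < j" "tail G (x i) = tail G (x j)"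
    using LeastI_ex[OF ex] unfolding j_def by blast
  have least: "tail G (x i') \<noteq> tail G (x j')" if "i' < j'" "j' < j" for i' j'
    using not_less_Least[of j'] that unfolding j_def by blast
  define p where "p = map x [i..<j]"
  have "distinct (map (tail G) p)"
  proof -
    have "inj_on (\<lambda>i. tail G (x i)) {i..<j}"
      by (rule linorder_inj_onI) (use least in auto)
    then show ?thesis by (simp add: p_def distinct_map comp_def)
  qed
  moreover have "map (head G) p = rotate1 (map (tail G) p)"
  proof -
    have "[i..<j] = i # [Suc i..<j]" using i(1) by (simp add: upt_conv_Cons)
    then have "rotate1 (map (tail G) p) = map (\<lambda>m. tail G (x m)) [Suc i..<j] @ [tail G (x j)]"
      using i(2) by (simp add: p_def)
    also have "\<dots> = map (\<lambda>m. tail G (x m)) [Suc i..<Suc j]" using i(1) by simp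
    also have "\<dots> = map (\<lambda>m. tail G (x (Suc m))) [i..<j]"
      by (simp only: map_Suc_upt[symmetric] map_map comp_def)
    finally show ?thesis by (simp add: p_def xS comp_def)
  qed
  ultimately have "cycle p"
    unfolding cycle_iff_rotate using R(1) xR i(1) by (auto simp: p_def)
  moreover have "set p \<subseteq> R" using xR by (auto simp: p_def)
  moreover have "ok (p ! m) (p ! Suc m)" if "Suc m < length p" for m
    using that xS(2) by (auto simp: p_def)
  ultimately show ?thesis using that by blast
qed

section \<open>Potentials\<close>

text \<open>A closed walk that is not simple splits into two shorter closed walks.\<close>

lemma (in wf_digraph) closed_walk_cost_nonneg:
  fixes c :: "'b \<Rightarrow> int"
  assumes nonneg: "\<And>p. cycle p \<Longrightarrow> 0 \<le> sum_list (map c p)"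
  shows "awalk u p u \<Longrightarrow> 0 \<le> sum_list (map c p)"
proof (induction "length p" arbitrary: u p rule: less_induct)
  case less
  show ?case
  proof (cases p)
    case (Cons e es)
    have e: "e \<in> arcs G" "tail G e = u" and es: "awalk (head G e) es u"
      using less.prems by (auto simp: Cons awalk_Cons_iff)
    show ?thesis
    proof (cases "distinct (awalk_verts (head G e) es)")
      case True
      then have "cycle p" unfolding cycle_def using less.prems by (auto simp: Cons)
      then show ?thesis by (rule nonneg)
    next
      case False
      then obtain q r s w where qrs: "es = q @ r @ s" "0 < length r"
        "awalk (head G e) q w" "awalk w r w" "awalk w s u"
        using awalk_not_distinct_decomp[OF es] by blast
      have "awalk (head G e) (q @ s) u" using qrs by auto
      then have "awalk u (e # q @ s) u" using e by (simp add: awalk_Cons_iff arc_def)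
      then have "0 \<le> sum_list (map c (e # q @ s))"
        using less.hyps[of "e # q @ s" u] qrs by (simp add: Cons)
      moreover have "0 \<le> sum_list (map c r)"
        using less.hyps[of r w] qrs by (simp add: Cons)
      ultimately show ?thesis by (simp add: Cons qrs)
    qed
  qed simp
qed

text \<open>The potential of a node is the cheapest cost of a path that ends there; cutting closed pieces
  out of a walk does not make it more expensive, so the triangle inequality holds.\<close>

lemma (in fin_digraph) potential_exists:
  fixes c :: "'b \<Rightarrow> int"
  assumes nonneg: "\<And>p. cycle p \<Longrightarrow> 0 \<le> sum_list (map c p)"
  shows "\<exists>\<pi> :: 'a \<Rightarrow> int. \<forall>e\<in>arcs G. \<pi> (head G e) \<le> \<pi> (tail G e) + c e"
proof -
  have path: "\<exists>q. apath u q v \<and> sum_list (map c q) \<le> sum_list (map c p)" if "awalk u p v" for u p v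
    using that
  proof (induction "length p" arbitrary: p rule: less_induct)
    case less
    show ?case
    proof (cases "distinct (awalk_verts u p)")
      case True
      then show ?thesis using less.prems by (auto simp: apath_def)
    next
      case False
      then obtain q r s w where qrs: "p = q @ r @ s" "0 < length r"
        "awalk u q w" "awalk w r w" "awalk w s v"
        using awalk_not_distinct_decomp[OF less.prems] by blast
      have "awalk u (q @ s) v" using qrs by auto
      then obtain q' where "apath u q' v" "sum_list (map c q') \<le> sum_list (map c (q @ s))"
        using less.hyps[of "q @ s"] qrs by auto
      moreover have "0 \<le> sum_list (map c r)"
        using closed_walk_cost_nonneg[OF nonneg] qrs(4) by blast
      ultimately show ?thesis by (intro exI[of _ q']) (simp add: qrs(1))
    qed
  qed
  define costs where "costs v = (\<lambda>p. sum_list (map c p)) ` {p. \<exists>u. apath u p v}" for v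
  have fin: "finite (costs v)" for v
  proof -
    have "{p. \<exists>u. apath u p v} \<subseteq> (fst \<circ> snd) ` {(u,p,v). apath u p v}" by force
    then show ?thesis
      unfolding costs_def using apaths_finite_triple finite_surj by (intro finite_imageI) blast
  qed
  show ?thesis
  proof (intro exI[of _ "\<lambda>v. Min (costs v)"] ballI)
    fix e assume e: "e \<in> arcs G"
    have "apath (tail G e) [] (tail G e)" using e by (simp add: apath_Nil_iff)
    then have "costs (tail G e) \<noteq> {}" unfolding costs_def by blast
    from Min_in[OF fin this] obtain u p
      where p: "apath u p (tail G e)" "Min (costs (tail G e)) = sum_list (map c p)"
      unfolding costs_def by blast
    have "awalk u (p @ [e]) (head G e)"
      using p(1) e by (auto simp: apath_def arc_def awalk_simps)
    from path[OF this] obtain q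
      where q: "apath u q (head G e)" "sum_list (map c q) \<le> sum_list (map c (p @ [e]))" by blast
    then have "Min (costs (head G e)) \<le> sum_list (map c q)"
      by (intro Min_le fin) (auto simp: costs_def)
    then show "Min (costs (head G e)) \<le> Min (costs (tail G e)) + c e" using p q by simp
  qed
qed

section \<open>Traversals of circuits\<close>

lemma both_ways_simps [simp]:
  "verts (both_ways C) = verts C"
  "arcs (both_ways C) = arcs C \<times> UNIV"
  "tail (both_ways C) s = (if snd s then tail C (fst s) else head C (fst s))"
  "head (both_ways C) s = (if snd s then head C (fst s) else tail C (fst s))"
  by (auto simp: both_ways_def split: prod.splits)

lemma (in wf_digraph) wf_digraph_both_ways: "wf_digraph (both_ways G)"
  by unfold_locales auto

lemma (in fin_digraph) fin_digraph_both_ways: "fin_digraph (both_ways G)"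
  by unfold_locales auto

definition turn_back :: "'b \<times> bool \<Rightarrow> 'b \<times> bool" where
  "turn_back s = (fst s, \<not> snd s)"

lemma turn_back_simps [simp]:
  "fst (turn_back s) = fst s" "snd (turn_back s) = (\<not> snd s)" "turn_back (turn_back s) = s"
  by (simp_all add: turn_back_def)

lemma same_arc_cases: "fst r = fst s \<Longrightarrow> r = s \<or> r = turn_back s"
  by (auto simp: turn_back_def prod_eq_iff)

lemma (in fin_digraph) circuit_card_incident:
  assumes "circuit G" "v \<in> verts G"
  shows "card (in_arcs G v \<union> out_arcs G v) + card (in_arcs G v \<inter> out_arcs G v) = 2"
  using assms card_Un_Int[OF finite_in_arcs finite_out_arcs, of v v]
  by (simp add: circuit_def in_degree_def out_degree_def)

text \<open>A node of degree 2 has no third arc end; a loop, which occurs here as \<open>e1 = e2\<close>, occupies two.\<close>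

lemma (in fin_digraph) circuit_incident_le2:
  assumes circ: "circuit G" and v: "v \<in> verts G"
    and e: "{e1, e2, e3} \<subseteq> in_arcs G v \<union> out_arcs G v" "e1 \<noteq> e3" "e2 \<noteq> e3"
    and "e1 = e2 \<Longrightarrow> e1 \<in> in_arcs G v \<inter> out_arcs G v"
  shows False
proof -
  have fin: "finite (in_arcs G v \<union> out_arcs G v)" "finite (in_arcs G v \<inter> out_arcs G v)" by auto
  have c: "card {e1, e2, e3} \<le> card (in_arcs G v \<union> out_arcs G v)"
    by (rule card_mono[OF fin(1) e(1)])
  show False
  proof (cases "e1 = e2")
    case True
    then have "card (in_arcs G v \<inter> out_arcs G v) > 0"
      using assms(6) fin(2) card_gt_0_iff by blast
    then show False using c e True circuit_card_incident[OF circ v] by simp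
  next
    case False
    then show False using c e circuit_card_incident[OF circ v] by simp
  qed
qed

text \<open>As every degree is 2, a step that enters a node can be continued along another arc (or around
  the same loop), and following such continuations yields a cycle that never turns back. Its nodes
  have no further incident arc, so by connectedness it exhausts the circuit.\<close>

lemma (in fin_digraph) circuit_has_traversal:
  assumes circ: "circuit G"
  shows "\<exists>p. traversal G p"
proof -
  interpret W: fin_digraph "both_ways G" by (rule fin_digraph_both_ways)
  have conn: "verts G \<noteq> {}"
    "\<And>u v. u \<in> verts G \<Longrightarrow> v \<in> verts G \<Longrightarrow> (u, v) \<in> rtrancl_on (verts G) ((arcs_ends G)\<^sup>s)"
    using circ by (auto simp: circuit_def connected_conv)
  have arcs_ne: "arcs G \<noteq> {}"
  proof
    assume "arcs G = {}"
    then have "in_arcs G v = {}" "out_arcs G v = {}" for v by (auto simp: in_arcs_def out_arcs_def)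
    then show False using circ conn(1) by (auto simp: circuit_def in_degree_def out_degree_def)
  qed
  have continue: "\<exists>s'\<in>arcs (both_ways G). tail (both_ways G) s' = head (both_ways G) s \<and> s' \<noteq> turn_back s"
    if s: "s \<in> arcs (both_ways G)" for s
  proof (cases "tail G (fst s) = head G (fst s)")
    case True
    then show ?thesis using s by (intro bexI[of _ s]) (auto simp: turn_back_def prod_eq_iff)
  next
    case False
    define v where "v = head (both_ways G) s"
    have v: "v \<in> verts G" using W.head_in_verts[OF s] by (simp add: v_def)
    have "\<not> in_arcs G v \<union> out_arcs G v \<subseteq> {fst s}"
    proof
      assume sub: "in_arcs G v \<union> out_arcs G v \<subseteq> {fst s}"
      then have "in_arcs G v \<inter> out_arcs G v = {}"
        using False by (auto simp: in_arcs_def out_arcs_def)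
      moreover have "card (in_arcs G v \<union> out_arcs G v) \<le> 1"
        using card_mono[OF _ sub] by simp
      ultimately show False using circuit_card_incident[OF circ v] by simp
    qed
    then obtain e where e: "e \<in> in_arcs G v \<union> out_arcs G v" "e \<noteq> fst s" by blast
    then show ?thesis
      unfolding v_def[symmetric]
      by (intro bexI[of _ "(e, tail G e = v)"]) (auto simp: in_arcs_def out_arcs_def turn_back_def)
  qed
  obtain p where p: "W.cycle p" and "set p \<subseteq> arcs (both_ways G)"
    and no_turn: "\<And>i. Suc i < length p \<Longrightarrow> p ! Suc i \<noteq> turn_back (p ! i)"
    by (rule W.cycle_from_successors[of "arcs (both_ways G)" "\<lambda>s s'. s' \<noteq> turn_back s"])
      (use arcs_ne continue in auto)
  have p_arcs: "fst s \<in> arcs G" if "s \<in> set p" for s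
    using \<open>set p \<subseteq> _\<close> that by auto
  have inj: "inj_on fst (set p)"
  proof (rule inj_onI, rule ccontr)
    fix r s assume rs: "r \<in> set p" "s \<in> set p" "fst r = fst s" "r \<noteq> s"
    \<comment> \<open>The later of the two steps would have to follow the earlier one immediately.\<close>
    have False if ij: "i < j" "j < length p" "p ! j = turn_back (p ! i)" for i j
    proof -
      have "tail (both_ways G) (p ! j) = head (both_ways G) (p ! i)" using ij(3) by simp
      also have "\<dots> = tail (both_ways G) (p ! Suc i)"
        using W.cycle_nth_head[OF p, of i] ij by simp
      finally have "p ! j = p ! Suc i"
        using W.cycle_inj_on_tail[OF p] ij(1,2)
        by (meson inj_onD less_trans_Suc nth_mem order.strict_trans)
      then show False using no_turn[of i] ij by simp
    qed
    moreover obtain i j where "i < length p" "p ! i = r" "j < length p" "p ! j = s"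
      using rs by (meson in_set_conv_nth)
    moreover have "s = turn_back r" "r = turn_back s" using rs same_arc_cases by metis+
    ultimately show False using rs(4) by (metis linorder_neqE_nat)
  qed
  define V where "V = tail (both_ways G) ` set p"
  have V_verts: "V \<subseteq> verts G" using W.tail_in_verts p_arcs by (force simp: V_def)
  have incident: "e \<in> fst ` set p" if v: "v \<in> V" and e: "e \<in> in_arcs G v \<union> out_arcs G v" for v e
  proof (rule ccontr)
    assume contr: "e \<notin> fst ` set p"
    obtain s' where s': "s' \<in> set p" "tail (both_ways G) s' = v" using v by (auto simp: V_def)
    obtain s where s: "s \<in> set p" "head (both_ways G) s = v"
      using v W.cycle_head_image[OF p] unfolding V_def by (metis imageE)
    show False
    proof (rule circuit_incident_le2[OF circ])
      show "v \<in> verts G" using v V_verts by blast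
      show "{fst s, fst s', e} \<subseteq> in_arcs G v \<union> out_arcs G v"
        using e s s' p_arcs by (auto simp: in_arcs_def out_arcs_def split: if_splits)
      show "fst s \<noteq> e" "fst s' \<noteq> e" using s s' contr by auto
      show "fst s \<in> in_arcs G v \<inter> out_arcs G v" if "fst s = fst s'"
      proof -
        have "s = s'" using inj s(1) s'(1) that by (auto simp only: inj_on_def)
        then show ?thesis using s s' p_arcs[of s] by (auto simp: in_arcs_def out_arcs_def split: if_splits)
      qed
    qed
  qed
  have "arcs G \<subseteq> fst ` set p"
  proof
    fix e assume e: "e \<in> arcs G"
    have head_V: "head (both_ways G) s \<in> V" if "s \<in> set p" for s
      using that W.cycle_head_image[OF p] by (auto simp only: V_def)
    have closed: "y \<in> V" if x: "x \<in> V" and xy: "(x, y) \<in> (arcs_ends G)\<^sup>s" for x y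
    proof -
      obtain f where f: "f \<in> arcs G" "tail G f = x \<and> head G f = y \<or> tail G f = y \<and> head G f = x"
        using xy by (auto simp: symcl_def arcs_ends_conv)
      then have "f \<in> fst ` set p" using incident[OF x, of f] by (auto simp: in_arcs_def out_arcs_def)
      then obtain s where s: "s \<in> set p" "fst s = f" by auto
      have "tail (both_ways G) s \<in> V" using s(1) by (auto simp only: V_def)
      then show ?thesis using head_V[OF s(1)] s(2) f(2) x by (auto split: if_splits)
    qed
    have "set p \<noteq> {}" using p by (simp add: W.cycle_iff_rotate)
    then have "V \<noteq> {}" unfolding V_def by (simp only: image_is_empty not_False_eq_True)
    then obtain u where u: "u \<in> V" by blast
    have "(u, tail G e) \<in> rtrancl_on (verts G) ((arcs_ends G)\<^sup>s)"
      by (rule conn(2)) (use u V_verts e in auto)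
    moreover have "y \<in> V" if "(x, y) \<in> rtrancl_on (verts G) ((arcs_ends G)\<^sup>s)" "x \<in> V" for x y
      using that by (induction rule: rtrancl_on.induct) (use closed in blast)+
    ultimately have "tail G e \<in> V" using u by blast
    then show "e \<in> fst ` set p" using incident e by (auto simp: out_arcs_def)
  qed
  then have "traversal G p"
    unfolding traversal_def using p inj p_arcs W.cycle_distinct[OF p] by (auto simp: distinct_map)
  then show ?thesis ..
qed

lemma (in fin_digraph) traversal_tail_image:
  assumes "circuit G" "traversal G p"
  shows "tail (both_ways G) ` set p = verts G"
proof
  interpret W: fin_digraph "both_ways G" by (rule fin_digraph_both_ways)
  have p: "W.cycle p" and arcs: "fst ` set p = arcs G"
    using assms(2) by (auto simp: traversal_def)
  show "tail (both_ways G) ` set p \<subseteq> verts G"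
    using arcs W.tail_in_verts by fastforce
  show "verts G \<subseteq> tail (both_ways G) ` set p"
  proof
    fix v assume v: "v \<in> verts G"
    have "in_arcs G v \<union> out_arcs G v \<noteq> {}"
    proof
      assume "in_arcs G v \<union> out_arcs G v = {}"
      then show False using circuit_card_incident[OF assms(1) v] by simp
    qed
    then obtain e where "e \<in> arcs G" "tail G e = v \<or> head G e = v"
      by (auto simp: in_arcs_def out_arcs_def)
    then obtain s where s: "s \<in> set p" "tail G (fst s) = v \<or> head G (fst s) = v"
      using arcs by (metis imageE)
    then have "tail (both_ways G) s = v \<or> head (both_ways G) s = v" by auto
    then have "v \<in> tail (both_ways G) ` set p \<union> head (both_ways G) ` set p" using s(1) by blast
    then show "v \<in> tail (both_ways G) ` set p" using W.cycle_head_image[OF p] by blast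
  qed
qed

lemma (in wf_digraph) traversal_rev:
  assumes "traversal G p"
  shows "traversal G (rev (map turn_back p))"
proof -
  interpret W: wf_digraph "both_ways G" by (rule wf_digraph_both_ways)
  let ?q = "rev (map turn_back p)"
  have p: "p \<noteq> []" "set p \<subseteq> arcs G \<times> UNIV"
    "map (head (both_ways G)) p = rotate1 (map (tail (both_ways G)) p)"
    "distinct (map (tail (both_ways G)) p)"
    and fst: "distinct (map fst p)" "set (map fst p) = arcs G"
    using assms by (auto simp only: traversal_def W.cycle_iff_rotate both_ways_simps)
  have flip: "head (both_ways G) (turn_back s) = tail (both_ways G) s"
    "tail (both_ways G) (turn_back s) = head (both_ways G) s" for s by auto
  have rot: "rev xs = rotate1 (rev (rotate1 xs))" for xs :: "'a list"
    by (cases xs) auto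
  have heads: "map (head (both_ways G)) ?q = rev (map (tail (both_ways G)) p)"
    and tails: "map (tail (both_ways G)) ?q = rev (map (head (both_ways G)) p)"
    by (simp_all only: rev_map map_map comp_def flip)
  have "map fst ?q = rev (map fst p)" by (simp add: rev_map)
  moreover have "W.cycle ?q"
    unfolding W.cycle_iff_rotate heads tails p(3) both_ways_simps(2)
  proof (intro conjI)
    show "?q \<noteq> []" using p(1) by simp
    show "set ?q \<subseteq> arcs G \<times> UNIV" using p(2) by (auto simp: turn_back_def)
    show "rev (map (tail (both_ways G)) p) = rotate1 (rev (rotate1 (map (tail (both_ways G)) p)))"
      by (rule rot)
    show "distinct (rev (rotate1 (map (tail (both_ways G)) p)))"
      using p(4) by (simp only: distinct_rev distinct1_rotate)
  qed
  ultimately show ?thesis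
    unfolding traversal_def using fst by (simp only: distinct_rev set_rev simp_thms)
qed

lemma forward_count_eq_card: "distinct p \<Longrightarrow> forward_count p = card {s \<in> set p. snd s}"
  using distinct_card[of "filter snd p"] by (simp add: forward_count_def)

lemma backward_count_eq_card: "distinct p \<Longrightarrow> backward_count p = card {s \<in> set p. \<not> snd s}"
  using distinct_card[of "filter (\<lambda>s. \<not> snd s) p"] by (simp add: backward_count_def)

text \<open>After a common step, two traversals of a circuit must continue alike: the only other way to go
  on would be to turn back.\<close>

lemma (in wf_digraph) traversal_same_steps:
  assumes p: "traversal G p" and q: "traversal G q" and s: "s \<in> set p" "s \<in> set q"
  shows "set p = set q"
proof -
  interpret W: wf_digraph "both_ways G" by (rule wf_digraph_both_ways)
  have sub: "set p \<subseteq> set q" if p: "traversal G p" and q: "traversal G q" and s: "s \<in> set p" "s \<in> set q"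
    for p q
  proof
    have cyc: "W.cycle p" "W.cycle q" and fst: "fst ` set p = arcs G" "fst ` set q = arcs G"
      and inj: "inj_on fst (set q)"
      using p q by (auto simp: traversal_def distinct_map)
    fix f assume "f \<in> set p"
    show "f \<in> set q"
    proof (rule W.cycle_propagate[where P="\<lambda>s. s \<in> set q", OF cyc(1) s])
      show "f \<in> set p" by fact
      fix e e' assume e: "e \<in> set p" "e \<in> set q" and e': "e' \<in> set p"
        and next': "tail (both_ways G) e' = head (both_ways G) e"
      have "head (both_ways G) e \<in> tail (both_ways G) ` set q"
        using W.cycle_head_image[OF cyc(2)] e(2) by blast
      then obtain r where r: "r \<in> set q" "tail (both_ways G) r = head (both_ways G) e" by auto
      then obtain t where t: "t \<in> set p" "fst t = fst r" using fst by (metis imageE imageI)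
      consider "t = r" | "t = turn_back r" using same_arc_cases[OF t(2)] by blast
      then show "e' \<in> set q"
      proof cases
        case 1
        then have "t = e'"
          using W.cycle_inj_on_tail[OF cyc(1)] t(1) e' r(2) next' by (metis inj_onD)
        then show ?thesis using 1 r(1) by simp
      next
        case 2
        then have "head (both_ways G) t = tail (both_ways G) r" by simp
        then have "t = e"
          using W.cycle_inj_on_head[OF cyc(1)] t(1) e(1) r(2) by (metis inj_onD)
        then have "fst e = fst r" "snd e \<noteq> snd r" using 2 by auto
        then show ?thesis using inj e(2) r(1) by (metis inj_onD)
      qed
    qed
  qed
  show ?thesis using sub[OF p q s] sub[OF q p s(2,1)] by blast
qed

text \<open>Any two traversals share a step, possibly after one of them is reversed, and reversal only swaps
  the two counts.\<close>

lemma (in wf_digraph) eta_eq_min_counts: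
  assumes p: "traversal G p"
  shows "eta G = min (forward_count p) (backward_count p)"
proof -
  interpret W: wf_digraph "both_ways G" by (rule wf_digraph_both_ways)
  have same: "forward_count q = forward_count r \<and> backward_count q = backward_count r"
    if "traversal G q" "traversal G r" "s \<in> set q" "s \<in> set r" for q r s
  proof -
    have "distinct q" "distinct r"
      using that(1,2) by (auto simp: traversal_def intro: W.cycle_distinct)
    then show ?thesis
      using traversal_same_steps[OF that] by (simp add: forward_count_eq_card backward_count_eq_card)
  qed
  have min_eq: "min (forward_count q) (backward_count q) = min (forward_count p) (backward_count p)"
    if q: "traversal G q" for q
  proof -
    obtain s where s: "s \<in> set p"
      using p by (cases p) (auto simp: traversal_def W.cycle_iff_rotate)
    then have "fst s \<in> fst ` set q" using p q by (auto simp: traversal_def)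
    then obtain r where r: "r \<in> set q" "fst r = fst s" by auto
    then consider "r = s" | "s = turn_back r" using same_arc_cases by metis
    then show ?thesis
    proof cases
      case 1
      then show ?thesis using same[OF p q s] r(1) by simp
    next
      case 2
      then have "s \<in> set (rev (map turn_back q))" using r(1) by auto
      then have "forward_count p = forward_count (rev (map turn_back q))"
        "backward_count p = backward_count (rev (map turn_back q))"
        using same[OF p traversal_rev[OF q] s] by auto
      moreover have "forward_count (rev (map turn_back q)) = backward_count q"
        "backward_count (rev (map turn_back q)) = forward_count q"
        by (simp_all add: forward_count_def backward_count_def rev_filter[symmetric] filter_map comp_def)
      ultimately show ?thesis by (simp add: min.commute)
    qed
  qed
  show ?thesis
    unfolding eta_def Let_def by (rule min_eq) (rule someI[of "traversal G", OF p])
qed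

definition traced :: "('a,'b) pre_digraph \<Rightarrow> ('b \<times> bool) list \<Rightarrow> ('a,'b) pre_digraph" where
  "traced D p = \<lparr> verts = tail (both_ways D) ` set p, arcs = fst ` set p, tail = tail D, head = head D \<rparr>"

lemma traced_simps [simp]:
  "verts (traced D p) = tail (both_ways D) ` set p" "arcs (traced D p) = fst ` set p"
  "tail (traced D p) = tail D" "head (traced D p) = head D"
  by (simp_all add: traced_def)

text \<open>Every node of a simple cycle is the head of exactly one step and the tail of exactly one step; as
  no arc serves two steps, these are two arc ends, so the degree is 2.\<close>

lemma (in fin_digraph) cycle_traces_circuit:
  assumes cyc: "pre_digraph.cycle (both_ways G) p" and dist: "distinct (map fst p)"
  shows "traced G p \<in> circuits G" "traversal (traced G p) p"
proof -
  interpret W: fin_digraph "both_ways G" by (rule fin_digraph_both_ways)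
  let ?C = "traced G p"
  have p: "p \<noteq> []" "set p \<subseteq> arcs (both_ways G)" using cyc W.cycle_iff_rotate by auto
  have tail_in: "tail (both_ways G) s \<in> verts ?C" if "s \<in> set p" for s
    using that by (simp only: traced_simps image_eqI)
  have head_in: "head (both_ways G) s \<in> verts ?C" if "s \<in> set p" for s
    using W.cycle_head_image[OF cyc] that unfolding traced_simps by blast
  have ends: "tail G (fst s) \<in> verts ?C \<and> head G (fst s) \<in> verts ?C" if "s \<in> set p" for s
    using tail_in[OF that] head_in[OF that] by (auto split: if_splits)
  interpret C: fin_digraph ?C
  proof
    show "finite (verts ?C)" "finite (arcs ?C)" by simp_all
  qed (use ends in \<open>auto simp only: traced_simps\<close>)
  interpret WC: fin_digraph "both_ways ?C" by (rule C.fin_digraph_both_ways)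
  have sub: "subgraph ?C G"
    unfolding subgraph_def compatible_def
    using p(2) W.tail_in_verts by (auto simp: C.wf_digraph_axioms wf_digraph_axioms)
  have same: "tail (both_ways ?C) = tail (both_ways G)" "head (both_ways ?C) = head (both_ways G)"
    by (simp_all add: fun_eq_iff)
  show trav: "traversal ?C p"
    unfolding traversal_def WC.cycle_iff_rotate same
    using cyc dist by (auto simp: W.cycle_iff_rotate simp del: both_ways_simps(3,4) intro: rev_image_eqI)
  have "in_degree ?C v + out_degree ?C v = 2" if v: "v \<in> verts ?C" for v
  proof -
    have one: "card {s \<in> set p. f s = v} = 1" if "inj_on f (set p)" "v \<in> f ` set p" for f
    proof -
      obtain s where s: "s \<in> set p" "f s = v" using \<open>v \<in> f ` set p\<close> by auto
      then have "{s \<in> set p. f s = v} = {s}" using that(1) by (auto dest: inj_onD)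
      then show ?thesis by simp
    qed
    have "in_degree ?C v + out_degree ?C v =
      (\<Sum>e\<in>fst ` set p. of_bool (head G e = v) + of_bool (tail G e = v))"
      by (simp add: in_degree_def out_degree_def in_arcs_def out_arcs_def sum.distrib
          sum.If_cases of_bool_def Int_def del: sum.reindex)
    also have "\<dots> = (\<Sum>s\<in>set p. of_bool (head G (fst s) = v) + of_bool (tail G (fst s) = v))"
      using dist by (simp add: sum.reindex distinct_map)
    also have "\<dots> = (\<Sum>s\<in>set p. of_bool (head (both_ways G) s = v) + of_bool (tail (both_ways G) s = v))"
      by (rule sum.cong) auto
    also have "\<dots> = card {s \<in> set p. head (both_ways G) s = v} + card {s \<in> set p. tail (both_ways G) s = v}"
      by (simp add: sum.distrib sum.If_cases of_bool_def Int_def del: both_ways_simps(3,4))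
    also have "\<dots> = 2"
      using one[OF W.cycle_inj_on_head[OF cyc]] one[OF W.cycle_inj_on_tail[OF cyc]] v
        W.cycle_head_image[OF cyc] by (simp only: traced_simps)
    finally show ?thesis .
  qed
  moreover have "connected ?C"
    unfolding connected_conv
  proof (intro conjI ballI)
    show "verts ?C \<noteq> {}" unfolding traced_simps using p(1) by (cases p) blast+
    let ?R = "rtrancl_on (verts ?C) ((arcs_ends ?C)\<^sup>s)"
    fix u v assume u: "u \<in> verts ?C" and v: "v \<in> verts ?C"
    obtain s where s: "s \<in> set p" "tail (both_ways G) s = u" using u unfolding traced_simps by blast
    obtain t where t: "t \<in> set p" "tail (both_ways G) t = v" using v unfolding traced_simps by blast
    have "(u, tail (both_ways G) t) \<in> ?R"
    proof (rule W.cycle_propagate[OF cyc s(1) _ _ t(1)])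
      show "(u, tail (both_ways G) s) \<in> ?R" using s(2) u by blast
      fix e e' assume e: "e \<in> set p" "e' \<in> set p" "tail (both_ways G) e' = head (both_ways G) e"
        "(u, tail (both_ways G) e) \<in> ?R"
      have "(tail (both_ways G) e, head (both_ways G) e) \<in> (arcs_ends ?C)\<^sup>s"
        using e(1) by (auto simp: symcl_def arcs_ends_conv)
      then show "(u, tail (both_ways G) e') \<in> ?R"
        using e head_in[OF e(1)] by (metis rtrancl_on_into_rtrancl_on)
    qed
    then show "(u, v) \<in> ?R" using t(2) by simp
  qed
  ultimately show "?C \<in> circuits G"
    using sub by (simp only: circuits_def circuit_def mem_Collect_eq simp_thms ball_simps) blast
qed

section \<open>Sink-stability in terms of potentials\<close>

text \<open>The potential of a node is the number of dicuts whose shore contains it. No arc leaves a shore and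
  each arc enters at most one, by disjointness.\<close>

lemma (in fin_digraph) potential_of_dicuts:
  assumes dicuts: "\<forall>F\<in>\<F>. dicut G F" and disj: "pairwise disjnt \<F>"
  obtains \<pi> :: "'a \<Rightarrow> int" where "\<And>e. e \<in> arcs G \<Longrightarrow> \<pi> (head G e) = \<pi> (tail G e) + of_bool (e \<in> \<Union>\<F>)"
proof -
  have "\<forall>F\<in>\<F>. \<exists>Z. (\<forall>e\<in>arcs G. tail G e \<in> Z \<longrightarrow> head G e \<in> Z) \<and>
      F = {e \<in> arcs G. tail G e \<notin> Z \<and> head G e \<in> Z}"
    using dicuts unfolding dicut_def by fast
  from bchoice[OF this] obtain Z where
    Z: "\<And>F e. \<lbrakk>F \<in> \<F>; e \<in> arcs G\<rbrakk> \<Longrightarrow> tail G e \<in> Z F \<Longrightarrow> head G e \<in> Z F"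
      "\<And>F. F \<in> \<F> \<Longrightarrow> F = {e \<in> arcs G. tail G e \<notin> Z F \<and> head G e \<in> Z F}"
    by blast
  have "\<F> \<subseteq> Pow (arcs G)" using dicuts by (auto simp: dicut_def)
  then have fin: "finite \<F>" by (rule finite_subset) simp
  have "int (card {F \<in> \<F>. head G e \<in> Z F}) = int (card {F \<in> \<F>. tail G e \<in> Z F}) + of_bool (e \<in> \<Union>\<F>)"
    if e: "e \<in> arcs G" for e
  proof -
    have "{F \<in> \<F>. head G e \<in> Z F} = {F \<in> \<F>. tail G e \<in> Z F} \<union> {F \<in> \<F>. e \<in> F}"
      using Z e by blast
    moreover have "{F \<in> \<F>. tail G e \<in> Z F} \<inter> {F \<in> \<F>. e \<in> F} = {}"
      using Z(2) by blast
    moreover have "card {F \<in> \<F>. e \<in> F} = of_bool (e \<in> \<Union>\<F>)"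
    proof (cases "e \<in> \<Union>\<F>")
      case True
      then obtain F where F: "F \<in> \<F>" "e \<in> F" by blast
      then have "{F \<in> \<F>. e \<in> F} = {F}"
        using disj by (auto simp: pairwise_def disjnt_def)
      then show ?thesis using True by simp
    next
      case False
      then have none: "{F \<in> \<F>. e \<in> F} = {}" by blast
      show ?thesis unfolding none using False by simp
    qed
    ultimately show ?thesis using fin by (simp add: card_Un_disjoint)
  qed
  then show ?thesis by (rule that)
qed

text \<open>The dicuts are the boundaries of the upper level sets; as the potential grows by at most 1 along
  an arc, no arc lies in two of them.\<close>

lemma (in fin_digraph) dicuts_of_potential:
  fixes \<pi> :: "'a \<Rightarrow> int"
  assumes \<pi>: "\<And>e. e \<in> arcs G \<Longrightarrow> \<pi> (tail G e) \<le> \<pi> (head G e) \<and> \<pi> (head G e) \<le> \<pi> (tail G e) + 1"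
  obtains \<F> where "\<forall>F\<in>\<F>. dicut G F" "pairwise disjnt \<F>"
    "\<Union>\<F> = {e \<in> arcs G. \<pi> (head G e) \<noteq> \<pi> (tail G e)}"
proof
  let ?F = "\<lambda>j. {e \<in> arcs G. \<pi> (tail G e) < j \<and> j \<le> \<pi> (head G e)}"
  show "\<forall>F\<in>range ?F. dicut G F"
  proof
    fix F assume "F \<in> range ?F"
    then obtain j where F: "F = ?F j" by blast
    show "dicut G F"
      unfolding dicut_def F by (rule exI[of _ "{v \<in> verts G. j \<le> \<pi> v}"]) (use \<pi> in force)
  qed
  have level: "j = \<pi> (head G e)" if "e \<in> ?F j" for e j using \<pi>[of e] that by auto
  show "pairwise disjnt (range ?F)"
  proof (rule pairwiseI)
    fix A B assume "A \<in> range ?F" "B \<in> range ?F" "A \<noteq> B"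
    then obtain i j where "A = ?F i" "B = ?F j" by blast
    then show "disjnt A B" using level \<open>A \<noteq> B\<close> unfolding disjnt_iff by metis
  qed
  show "\<Union>(range ?F) = {e \<in> arcs G. \<pi> (head G e) \<noteq> \<pi> (tail G e)}"
    using \<pi> by force
qed

lemma (in fin_digraph) sink_stable_iff_potential:
  "sink_stable G S \<longleftrightarrow> S \<subseteq> verts G \<and>
     (\<exists>\<pi> :: 'a \<Rightarrow> int. \<forall>e\<in>arcs G. \<pi> (tail G e) + of_bool (tail G e \<in> S) \<le> \<pi> (head G e) \<and>
        \<pi> (head G e) + of_bool (head G e \<in> S) \<le> \<pi> (tail G e) + 1)"
    (is "_ \<longleftrightarrow> _ \<and> (\<exists>\<pi>. ?pot \<pi>)")
proof
  have sink: "sink_set (reverse_arcs U G) S \<longleftrightarrow>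
      S \<subseteq> verts G \<and> (\<forall>e\<in>arcs G. (tail G e \<in> S \<longrightarrow> e \<in> U) \<and> (head G e \<in> S \<longrightarrow> e \<notin> U))" for U
    by (auto simp: sink_set_def sink_node_def reverse_arcs_def out_arcs_def)
  {
    assume "sink_stable G S"
    then obtain \<F> where \<F>: "\<forall>F\<in>\<F>. dicut G F" "pairwise disjnt \<F>" "sink_set (reverse_arcs (\<Union>\<F>) G) S"
      unfolding sink_stable_def by blast
    obtain \<pi> :: "'a \<Rightarrow> int"
      where \<pi>: "\<And>e. e \<in> arcs G \<Longrightarrow> \<pi> (head G e) = \<pi> (tail G e) + of_bool (e \<in> \<Union>\<F>)"
      using potential_of_dicuts[OF \<F>(1,2)] by blast
    have "?pot \<pi>" using \<F>(3) unfolding sink by (auto simp: \<pi> of_bool_def)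
    then show "S \<subseteq> verts G \<and> (\<exists>\<pi>. ?pot \<pi>)" using \<F>(3) unfolding sink by blast
  next
    assume "S \<subseteq> verts G \<and> (\<exists>\<pi>. ?pot \<pi>)"
    then obtain \<pi> where S: "S \<subseteq> verts G" and \<pi>: "?pot \<pi>" by blast
    have "\<pi> (tail G e) \<le> \<pi> (head G e) \<and> \<pi> (head G e) \<le> \<pi> (tail G e) + 1" if "e \<in> arcs G" for e
      using bspec[OF \<pi> that] by (auto simp: of_bool_def split: if_splits)
    from dicuts_of_potential[of \<pi>, OF this] obtain \<F> where \<F>: "\<forall>F\<in>\<F>. dicut G F" "pairwise disjnt \<F>"
      "\<Union>\<F> = {e \<in> arcs G. \<pi> (head G e) \<noteq> \<pi> (tail G e)}" by blast
    have "sink_set (reverse_arcs (\<Union>\<F>) G) S"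
      unfolding sink \<F>(3)
    proof (intro conjI ballI S)
      fix e assume "e \<in> arcs G"
      with bspec[OF \<pi> this]
      show "tail G e \<in> S \<longrightarrow> e \<in> {e \<in> arcs G. \<pi> (head G e) \<noteq> \<pi> (tail G e)}"
        "head G e \<in> S \<longrightarrow> e \<notin> {e \<in> arcs G. \<pi> (head G e) \<noteq> \<pi> (tail G e)}"
        by (auto simp: of_bool_def split: if_splits)
    qed
    then show "sink_stable G S" unfolding sink_stable_def using \<F> by blast
  }
qed

text \<open>Each step of a traversal obeys two inequalities: one charges the head of the step, if it lies in
  \<open>S\<close>, to a forward step, the other charges the tail to a backward step. Summing over the traversal
  cancels the potential.\<close>

lemma (in fin_digraph) sink_stable_card_circuit_le:
  assumes C: "C \<in> circuits G" and S: "sink_stable G S"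
  shows "card (S \<inter> verts C) \<le> eta C"
proof -
  have sub: "subgraph C G" and circ: "circuit C" using C by (auto simp: circuits_def)
  have CG: "verts C \<subseteq> verts G" "arcs C \<subseteq> arcs G" "tail C = tail G" "head C = head G"
    using sub by (auto simp: subgraph_def compatible_def)
  interpret C: fin_digraph C
    using sub CG finite_subset[OF CG(1)] finite_subset[OF CG(2)]
    by (auto simp: subgraph_def fin_digraph_def fin_digraph_axioms_def)
  interpret W: fin_digraph "both_ways C" by (rule C.fin_digraph_both_ways)
  obtain p where p: "traversal C p" using C.circuit_has_traversal[OF circ] by blast
  have cyc: "W.cycle p" and dist: "distinct p" and arcs: "fst ` set p = arcs C"
    using p W.cycle_distinct by (auto simp: traversal_def)
  obtain \<pi> :: "'a \<Rightarrow> int" where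
    \<pi>: "\<And>e. e \<in> arcs G \<Longrightarrow> \<pi> (tail G e) + of_bool (tail G e \<in> S) \<le> \<pi> (head G e)"
      "\<And>e. e \<in> arcs G \<Longrightarrow> \<pi> (head G e) + of_bool (head G e \<in> S) \<le> \<pi> (tail G e) + 1"
    using S unfolding sink_stable_iff_potential by blast
  let ?t = "tail (both_ways C)" and ?h = "head (both_ways C)"
  have steps: "\<pi> (?h s) + of_bool (?h s \<in> S) \<le> \<pi> (?t s) + of_bool (snd s)"
    "\<pi> (?t s) + of_bool (?t s \<in> S) \<le> \<pi> (?h s) + of_bool (\<not> snd s)" if "s \<in> set p" for s
  proof -
    have "fst s \<in> arcs G" using that arcs CG(2) by blast
    from \<pi>[OF this] show "\<pi> (?h s) + of_bool (?h s \<in> S) \<le> \<pi> (?t s) + of_bool (snd s)"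
      "\<pi> (?t s) + of_bool (?t s \<in> S) \<le> \<pi> (?h s) + of_bool (\<not> snd s)"
      by (auto simp: CG)
  qed
  have pi_sum: "(\<Sum>s\<in>set p. \<pi> (?h s)) = (\<Sum>s\<in>set p. \<pi> (?t s))"
    by (rule W.cycle_sum_head_eq_tail[OF cyc])
  have on: "(\<Sum>s\<in>set p. of_bool (?t s \<in> S)) = int (card (S \<inter> verts C))"
  proof -
    have "(\<Sum>s\<in>set p. of_bool (?t s \<in> S)) = (\<Sum>v\<in>?t ` set p. of_bool (v \<in> S) :: int)"
      unfolding sum.reindex[OF W.cycle_inj_on_tail[OF cyc]] comp_def ..
    then show ?thesis
      unfolding C.traversal_tail_image[OF circ p] by (simp add: Int_commute Int_def)
  qed
  have "(\<Sum>s\<in>set p. \<pi> (?h s) + of_bool (?h s \<in> S)) \<le> (\<Sum>s\<in>set p. \<pi> (?t s) + of_bool (snd s))"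
    by (rule sum_mono) (rule steps(1))
  then have "(\<Sum>s\<in>set p. of_bool (?h s \<in> S)) \<le> (\<Sum>s\<in>set p. of_bool (snd s) :: int)"
    unfolding sum.distrib pi_sum by simp
  then have "int (card (S \<inter> verts C)) \<le> int (forward_count p)"
    unfolding W.cycle_sum_head_eq_tail[OF cyc, of "\<lambda>v. of_bool (v \<in> S)"] on
    by (simp add: forward_count_eq_card[OF dist] Int_def)
  moreover
  have "(\<Sum>s\<in>set p. \<pi> (?t s) + of_bool (?t s \<in> S)) \<le> (\<Sum>s\<in>set p. \<pi> (?h s) + of_bool (\<not> snd s))"
    by (rule sum_mono) (rule steps(2))
  then have "(\<Sum>s\<in>set p. of_bool (?t s \<in> S)) \<le> (\<Sum>s\<in>set p. of_bool (\<not> snd s) :: int)"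
    unfolding sum.distrib pi_sum by simp
  then have "int (card (S \<inter> verts C)) \<le> int (backward_count p)"
    unfolding on by (simp add: backward_count_eq_card[OF dist] Int_def)
  ultimately show ?thesis using C.eta_eq_min_counts[OF p] by simp
qed

lemma (in fin_digraph) k_sink_stable_card_circuit_le:
  assumes C: "C \<in> circuits G" and S: "k_sink_stable G k S"
  shows "card (S \<inter> verts C) \<le> k * eta C"
proof -
  obtain P where P: "\<And>i. i < k \<Longrightarrow> sink_stable G (P i)" "S = (\<Union>i<k. P i)"
    using S unfolding k_sink_stable_def by blast
  have "card (S \<inter> verts C) = card (\<Union>i<k. P i \<inter> verts C)" unfolding P(2) by (simp add: Int_UN_distrib2)
  also have "\<dots> \<le> (\<Sum>i<k. card (P i \<inter> verts C))" by (rule card_UN_le) simp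
  also have "\<dots> \<le> (\<Sum>i<k. eta C)"
    by (rule sum_mono) (use sink_stable_card_circuit_le[OF C] P(1) in auto)
  finally show ?thesis by simp
qed

text \<open>The parts are the residue classes of the potential modulo \<open>k\<close>. For each class, shift the potential
  so that the members of the class sit just below a multiple of \<open>k\<close>, divide by \<open>k\<close> and round down. This
  turns increments between 0 and \<open>k\<close> into increments 0 or 1. An arc that leaves a member has increment at
  least 1 and crosses the multiple; an arc that enters a member has increment at most \<open>k - 1\<close> and
  crosses none.\<close>

lemma (in fin_digraph) k_sink_stableI_potential:
  fixes \<pi> :: "'a \<Rightarrow> int"
  assumes k: "k > 0" and S: "S \<subseteq> verts G"
    and \<pi>: "\<And>e. e \<in> arcs G \<Longrightarrow> \<pi> (tail G e) + of_bool (tail G e \<in> S) \<le> \<pi> (head G e) \<and>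
        \<pi> (head G e) + of_bool (head G e \<in> S) \<le> \<pi> (tail G e) + int k"
  shows "k_sink_stable G k S"
proof -
  define P where "P i = {v \<in> S. (\<pi> v + int i) mod int k = int k - 1}" for i
  have "sink_stable G (P i)" for i
    unfolding sink_stable_iff_potential
  proof (intro conjI exI[of _ "\<lambda>v. (\<pi> v + int i) div int k"] ballI)
    show "P i \<subseteq> verts G" using S by (auto simp: P_def)
    fix e assume e: "e \<in> arcs G"
    define a b where "a = \<pi> (tail G e) + int i" and "b = \<pi> (head G e) + int i"
    have ab: "a + of_bool (tail G e \<in> P i) \<le> b" "b + of_bool (head G e \<in> P i) \<le> a + int k"
      using \<pi>[OF e] by (auto simp: a_def b_def P_def of_bool_def split: if_splits)
    have k0: "int k > 0" using k by simp
    have mods: "tail G e \<in> P i \<Longrightarrow> a mod int k = int k - 1" "head G e \<in> P i \<Longrightarrow> b mod int k = int k - 1"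
      by (auto simp: P_def a_def b_def)
    have "a div int k + of_bool (tail G e \<in> P i) \<le> b div int k"
    proof (cases "tail G e \<in> P i")
      case True
      then have "a + 1 = int k * (a div int k + 1)"
        using mods(1) mult_div_mod_eq[of "int k" a] unfolding distrib_left by linarith
      then have "a div int k + 1 = (a + 1) div int k" using k0 by simp
      also have "\<dots> \<le> b div int k" using ab True k0 by (intro zdiv_mono1) auto
      finally show ?thesis using True by simp
    next
      case False
      then show ?thesis using ab k0 by (auto intro: zdiv_mono1)
    qed
    moreover have "b div int k + of_bool (head G e \<in> P i) \<le> a div int k + 1"
    proof (cases "head G e \<in> P i")
      case True
      then have "b + 1 = int k * (b div int k + 1)"
        using mods(2) mult_div_mod_eq[of "int k" b] unfolding distrib_left by linarith
      then have "b div int k + 1 = (b + 1) div int k" using k0 by simp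
      also have "\<dots> \<le> (a + int k) div int k" using ab True k0 by (intro zdiv_mono1) auto
      finally show ?thesis using True k0 by simp
    next
      case False
      then have "b div int k \<le> (a + int k) div int k" using ab k0 by (intro zdiv_mono1) auto
      then show ?thesis using False k0 by simp
    qed
    ultimately show "(\<pi> (tail G e) + int i) div int k + of_bool (tail G e \<in> P i)
          \<le> (\<pi> (head G e) + int i) div int k"
      "(\<pi> (head G e) + int i) div int k + of_bool (head G e \<in> P i)
          \<le> (\<pi> (tail G e) + int i) div int k + 1"
      by (simp_all add: a_def b_def)
  qed
  moreover have "P i \<inter> P j = {}" if "i < k" "j < k" "i \<noteq> j" for i j
  proof -
    have False if "v \<in> P i" "v \<in> P j" for v
    proof -
      have "(\<pi> v + int i) mod int k = (\<pi> v + int j) mod int k" using that by (simp add: P_def)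
      then have "int k dvd (\<pi> v + int i) - (\<pi> v + int j)" by (simp only: mod_eq_dvd_iff)
      then have "int k dvd int i - int j" by simp
      then have "\<bar>int k\<bar> \<le> \<bar>int i - int j\<bar>" using \<open>i \<noteq> j\<close> by (intro dvd_imp_le_int) auto
      then show False using \<open>i < k\<close> \<open>j < k\<close> by linarith
    qed
    then show ?thesis by blast
  qed
  moreover have "S = (\<Union>i<k. P i)"
  proof
    show "(\<Union>i<k. P i) \<subseteq> S" by (auto simp: P_def)
    show "S \<subseteq> (\<Union>i<k. P i)"
    proof
      fix v assume v: "v \<in> S"
      define i where "i = nat ((int k - 1 - \<pi> v) mod int k)"
      have i: "int i = (int k - 1 - \<pi> v) mod int k" using k by (simp add: i_def)
      have "int i < int k" unfolding i using k by (intro pos_mod_bound) simp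
      then have "i < k" by simp
      moreover have "(\<pi> v + int i) mod int k = int k - 1"
      proof -
        have "(\<pi> v + int i) mod int k = (\<pi> v + (int k - 1 - \<pi> v)) mod int k"
          unfolding i by (simp only: mod_add_right_eq)
        also have "\<pi> v + (int k - 1 - \<pi> v) = int k - 1" by simp
        also have "(int k - 1) mod int k = int k - 1"
          by (rule mod_pos_pos_trivial) (use k in auto)
        finally show ?thesis .
      qed
      ultimately show "v \<in> (\<Union>i<k. P i)" using v by (auto simp: P_def)
    qed
  qed
  ultimately show ?thesis unfolding k_sink_stable_def by blast
qed

section \<open>Integral flows of minimum cost\<close>

definition flow_sum :: "'e set \<Rightarrow> ('e \<Rightarrow> nat) \<Rightarrow> ('e \<Rightarrow> int) \<Rightarrow> int" where
  "flow_sum A f \<psi> = (\<Sum>e\<in>A. int (f e) * \<psi> e)"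

abbreviation increment :: "('a,'e) pre_digraph \<Rightarrow> ('a \<Rightarrow> int) \<Rightarrow> 'e \<Rightarrow> int" where
  "increment G \<phi> e \<equiv> \<phi> (head G e) - \<phi> (tail G e)"

text \<open>Two flows have the same net supply at every node iff they pair equally with the increments of
  every function on the nodes. A potential is such a function, which makes this form convenient for
  duality.\<close>

definition same_boundary :: "('a,'e) pre_digraph \<Rightarrow> ('e \<Rightarrow> nat) \<Rightarrow> ('e \<Rightarrow> nat) \<Rightarrow> bool" where
  "same_boundary G f g \<longleftrightarrow>
     (\<forall>\<phi>. flow_sum (arcs G) f (increment G \<phi>) = flow_sum (arcs G) g (increment G \<phi>))"

lemma flow_sum_nonneg: "(\<And>e. e \<in> A \<Longrightarrow> 0 \<le> \<psi> e) \<Longrightarrow> 0 \<le> flow_sum A f \<psi>"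
  unfolding flow_sum_def by (intro sum_nonneg mult_nonneg_nonneg) auto

text \<open>Starting from \<open>f0\<close>, take a flow of the same boundary with minimum cost. In its residual digraph an
  arc may be used forward at its cost, and backward at the negated cost if it carries flow. Pushing one
  unit along a simple residual cycle keeps the boundary, so no such cycle has negative cost and a
  potential exists. It is tight on the arcs that carry flow, so the cost of the flow equals its pairing
  with the potential, which depends on the boundary only and can be evaluated at \<open>f0\<close>.\<close>

lemma (in fin_digraph) min_cost_flow_potential:
  fixes c :: "'b \<Rightarrow> int" and f0 :: "'b \<Rightarrow> nat"
  assumes c: "\<And>e. e \<in> arcs G \<Longrightarrow> 0 \<le> c e"
  shows "\<exists>f \<pi>. same_boundary G f f0 \<and>
    (\<forall>e\<in>arcs G. increment G \<pi> e \<le> c e) \<and>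
    flow_sum (arcs G) f c = flow_sum (arcs G) f0 (increment G \<pi>)"
proof -
  have "same_boundary G f0 f0" by (simp add: same_boundary_def)
  then obtain f where f: "same_boundary G f f0"
    and minf: "\<And>g. same_boundary G g f0 \<Longrightarrow> nat (flow_sum (arcs G) f c) \<le> nat (flow_sum (arcs G) g c)"
    using ex_has_least_nat[of "\<lambda>g. same_boundary G g f0" f0 "\<lambda>g. nat (flow_sum (arcs G) g c)"] by blast
  have min: "flow_sum (arcs G) f c \<le> flow_sum (arcs G) g c" if "same_boundary G g f0" for g
    using minf[OF that] flow_sum_nonneg[of "arcs G" c f] flow_sum_nonneg[of "arcs G" c g] c by auto
  let ?B = "both_ways G"
  define R where "R = ?B \<lparr>arcs := {s \<in> arcs ?B. snd s \<or> 0 < f (fst s)}\<rparr>"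
  have R: "verts R = verts G" "arcs R = {s \<in> arcs G \<times> UNIV. snd s \<or> 0 < f (fst s)}"
    "tail R = tail ?B" "head R = head ?B"
    by (simp_all add: R_def)
  interpret B: fin_digraph ?B by (rule fin_digraph_both_ways)
  interpret R: fin_digraph R
  proof
    show "finite (verts R)" "finite (arcs R)" unfolding R by auto
    fix s assume "s \<in> arcs R"
    then have "s \<in> arcs ?B" unfolding R by simp
    then have "tail ?B s \<in> verts ?B" "head ?B s \<in> verts ?B"
      by (rule B.tail_in_verts, rule B.head_in_verts)
    then show "tail R s \<in> verts R" "head R s \<in> verts R" unfolding R both_ways_simps(1) .
  qed
  define sgn where "sgn \<psi> s = (if snd s then \<psi> (fst s) else - \<psi> (fst s) :: int)"
    for \<psi> :: "'b \<Rightarrow> int" and s :: "'b \<times> bool"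
  have "0 \<le> sum_list (map (sgn c) p)" if p: "R.cycle p" for p
  proof -
    have dist: "distinct p" by (rule R.cycle_distinct[OF p])
    have sub: "set p \<subseteq> arcs R" using p by (simp add: R.cycle_iff_rotate)
    \<comment> \<open>The flow after pushing one unit along the cycle; it stays nonnegative because backward steps
      are available only on arcs that carry flow.\<close>
    define \<delta> where "\<delta> e = (of_bool ((e, True) \<in> set p) - of_bool ((e, False) \<in> set p) :: int)" for e
    define g where "g e = nat (int (f e) + \<delta> e)" for e
    have g: "int (g e) = int (f e) + \<delta> e" for e
    proof -
      have "(e, False) \<in> set p \<Longrightarrow> 0 < f e" using sub unfolding R by auto
      then show ?thesis by (auto simp: g_def \<delta>_def)
    qed
    have delta_sum: "(\<Sum>e\<in>arcs G. \<delta> e * \<psi> e) = (\<Sum>s\<in>set p. sgn \<psi> s)" for \<psi>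
    proof -
      have "(\<Sum>s\<in>set p. sgn \<psi> s) = (\<Sum>s\<in>arcs G \<times> UNIV. of_bool (s \<in> set p) * sgn \<psi> s)"
        using sub unfolding R by (subst sum_of_bool_mult_eq) (auto intro!: sum.cong)
      also have "\<dots> = (\<Sum>e\<in>arcs G. \<Sum>b\<in>UNIV. of_bool ((e, b) \<in> set p) * sgn \<psi> (e, b))"
        unfolding sum.cartesian_product by (rule sum.cong) auto
      also have "\<dots> = (\<Sum>e\<in>arcs G. \<delta> e * \<psi> e)"
        by (rule sum.cong) (auto simp: UNIV_bool sgn_def \<delta>_def)
      finally show ?thesis by simp
    qed
    have g_sum: "flow_sum (arcs G) g \<psi> = flow_sum (arcs G) f \<psi> + (\<Sum>s\<in>set p. sgn \<psi> s)" for \<psi>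
      unfolding flow_sum_def g delta_sum[symmetric] by (simp add: distrib_right sum.distrib)
    have "same_boundary G g f0"
      unfolding same_boundary_def
    proof
      fix \<phi>
      have "(\<Sum>s\<in>set p. sgn (increment G \<phi>) s) = (\<Sum>s\<in>set p. \<phi> (head R s) - \<phi> (tail R s))"
        unfolding R by (rule sum.cong) (auto simp: sgn_def)
      also have "\<dots> = 0"
        unfolding sum_subtractf by (simp add: R.cycle_sum_head_eq_tail[OF p, of \<phi>])
      finally show "flow_sum (arcs G) g (increment G \<phi>) = flow_sum (arcs G) f0 (increment G \<phi>)"
        using f by (simp add: g_sum same_boundary_def)
    qed
    then have "0 \<le> (\<Sum>s\<in>set p. sgn c s)" using min[of g] by (simp add: g_sum)
    then show ?thesis using dist by (simp add: sum_list_distinct_conv_sum_set)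
  qed
  from R.potential_exists[of "sgn c", OF this] obtain \<pi> :: "'a \<Rightarrow> int"
    where \<pi>: "\<And>s. s \<in> arcs R \<Longrightarrow> \<pi> (head R s) \<le> \<pi> (tail R s) + sgn c s" by blast
  have feas: "increment G \<pi> e \<le> c e" if "e \<in> arcs G" for e
    using \<pi>[of "(e, True)"] that unfolding R by (simp add: sgn_def)
  have tight: "increment G \<pi> e = c e" if "e \<in> arcs G" "0 < f e" for e
    using \<pi>[of "(e, False)"] feas[OF that(1)] that unfolding R by (simp add: sgn_def)
  have "flow_sum (arcs G) f c = flow_sum (arcs G) f (increment G \<pi>)"
    unfolding flow_sum_def by (rule sum.cong) (use tight in force)+
  also have "\<dots> = flow_sum (arcs G) f0 (increment G \<pi>)" using f by (simp add: same_boundary_def)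
  finally show ?thesis using f feas by blast
qed

section \<open>The network\<close>

text \<open>
  Every node \<open>v\<close> is split into an exit \<open>(v, False)\<close> and an entry \<open>(v, True)\<close>. A step along an arc leads
  from an exit to an entry. The link \<open>Short v\<close> goes from the exit of \<open>v\<close> to its entry at cost 1. The flow to
  start from has \<open>w v\<close> units on \<open>Short v\<close>, so that flows of the same boundary deliver \<open>w v\<close> units net
  into the entry of \<open>v\<close> and out of its exit, by steps or by the short link. The free link \<open>Excess v\<close>
  from entry to exit lets closed walks pass through \<open>v\<close> more than \<open>w v\<close> times.
\<close>

datatype ('a,'b) link = Step "'b \<times> bool" | Short 'a | Excess 'a

definition network :: "('a,'b) pre_digraph \<Rightarrow> ('a \<times> bool, ('a,'b) link) pre_digraph" where
  "network D = \<lparr> verts = verts D \<times> UNIV,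
     arcs = Step ` (arcs D \<times> UNIV) \<union> Short ` verts D \<union> Excess ` verts D,
     tail = (\<lambda>l. case l of Step s \<Rightarrow> (tail (both_ways D) s, False) | Short v \<Rightarrow> (v, False) | Excess v \<Rightarrow> (v, True)),
     head = (\<lambda>l. case l of Step s \<Rightarrow> (head (both_ways D) s, True) | Short v \<Rightarrow> (v, True) | Excess v \<Rightarrow> (v, False)) \<rparr>"

lemma network_simps [simp]:
  "verts (network D) = verts D \<times> UNIV"
  "arcs (network D) = Step ` (arcs D \<times> UNIV) \<union> Short ` verts D \<union> Excess ` verts D"
  "tail (network D) (Step s) = (tail (both_ways D) s, False)"
  "tail (network D) (Short v) = (v, False)" "tail (network D) (Excess v) = (v, True)"
  "head (network D) (Step s) = (head (both_ways D) s, True)"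
  "head (network D) (Short v) = (v, True)" "head (network D) (Excess v) = (v, False)"
  by (simp_all add: network_def)

lemma (in fin_digraph) fin_digraph_network: "fin_digraph (network G)"
  by unfold_locales auto

lemma (in fin_digraph) flow_sum_network:
  "flow_sum (arcs (network G)) f \<psi> = flow_sum (arcs G \<times> UNIV) (f \<circ> Step) (\<psi> \<circ> Step) +
     flow_sum (verts G) (f \<circ> Short) (\<psi> \<circ> Short) + flow_sum (verts G) (f \<circ> Excess) (\<psi> \<circ> Excess)"
proof -
  have "flow_sum (arcs (network G)) f \<psi> = flow_sum (Step ` (arcs G \<times> UNIV)) f \<psi> +
      flow_sum (Short ` verts G) f \<psi> + flow_sum (Excess ` verts G) f \<psi>"
    unfolding flow_sum_def network_simps by (subst sum.union_disjoint; auto)+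
  then show ?thesis unfolding flow_sum_def by (simp add: sum.reindex inj_on_def)
qed

fun link_cost :: "nat \<Rightarrow> ('a,'b) link \<Rightarrow> int" where
  "link_cost k (Step s) = int k * of_bool (snd s)"
| "link_cost k (Short v) = 1"
| "link_cost k (Excess v) = 0"

text \<open>Let \<open>p\<close> be the potential of an optimal flow in the network. The links \<open>Excess v\<close> and \<open>Short v\<close>
  force \<open>p (v, True) - p (v, False)\<close> to be 0 or 1, and \<open>S\<close> consists of the nodes where it is 1; the two
  steps along an arc give the two inequalities for \<open>\<pi> = p (_, False)\<close>.\<close>

lemma (in fin_digraph) optimal_circulation:
  fixes w :: "'a \<Rightarrow> nat"
  obtains h :: "'b \<times> bool \<Rightarrow> nat" and z :: "'a \<Rightarrow> nat" and S :: "'a set" and \<pi> :: "'a \<Rightarrow> int" where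
    "\<And>\<phi>. flow_sum (arcs G \<times> UNIV) h (increment (both_ways G) \<phi>) = 0"
    "\<And>v. v \<in> verts G \<Longrightarrow>
       int (w v) \<le> int (z v) + flow_sum (arcs G \<times> UNIV) h (\<lambda>s. of_bool (head (both_ways G) s = v))"
    "S \<subseteq> verts G"
    "\<And>e. e \<in> arcs G \<Longrightarrow> \<pi> (tail G e) + of_bool (tail G e \<in> S) \<le> \<pi> (head G e) \<and>
       \<pi> (head G e) + of_bool (head G e \<in> S) \<le> \<pi> (tail G e) + int k"
    "int k * flow_sum (arcs G \<times> UNIV) h (\<lambda>s. of_bool (snd s)) + (\<Sum>v\<in>verts G. int (z v)) = (\<Sum>v\<in>S. int (w v))"
proof -
  interpret N: fin_digraph "network G" by (rule fin_digraph_network)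
  define f0 where "f0 l = (case l of Short v \<Rightarrow> w v | _ \<Rightarrow> 0)" for l :: "('a,'b) link"
  have cost: "0 \<le> link_cost k l" for l :: "('a,'b) link" by (cases l) auto
  obtain f p where
    boundary: "same_boundary (network G) f f0"
    and feas: "\<And>l. l \<in> arcs (network G) \<Longrightarrow> increment (network G) p l \<le> link_cost k l"
    and tight: "flow_sum (arcs (network G)) f (link_cost k) = flow_sum (arcs (network G)) f0 (increment (network G) p)"
    using N.min_cost_flow_potential[of "link_cost k" f0, OF cost] by blast
  note same = boundary[unfolded same_boundary_def, rule_format]
  have start: "flow_sum (arcs (network G)) f0 \<psi> = (\<Sum>v\<in>verts G. int (w v) * \<psi> (Short v))" for \<psi>
    unfolding flow_sum_network by (simp add: flow_sum_def f0_def)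
  define h where "h = f \<circ> Step"
  define z where "z = f \<circ> Short"
  define x where "x v = p (v, True) - p (v, False)" for v
  define S where "S = {v \<in> verts G. x v = 1}"
  have x: "x v = of_bool (v \<in> S)" if "v \<in> verts G" for v
    using feas[of "Short v"] feas[of "Excess v"] that by (auto simp: x_def S_def)
  show ?thesis
  proof (rule that[of h z S "\<lambda>v. p (v, False)"])
    fix \<phi> :: "'a \<Rightarrow> int"
    \<comment> \<open>Testing the boundary with a function that does not separate entry from exit kills the short
      and excess links.\<close>
    have "flow_sum (arcs (network G)) f (increment (network G) (\<lambda>(v, b). \<phi> v)) = 0"
      unfolding same start by simp
    then show "flow_sum (arcs G \<times> UNIV) h (increment (both_ways G) \<phi>) = 0"
      unfolding flow_sum_network h_def by (simp add: flow_sum_def comp_def)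
  next
    fix v assume v: "v \<in> verts G"
    \<comment> \<open>Testing the boundary with the indicator of the entry of \<open>v\<close> gives the flow into that entry.\<close>
    define \<phi> where "\<phi> u = (of_bool (u = (v, True)) :: int)" for u
    have single: "(\<Sum>u\<in>verts G. a u * of_bool (u = v)) = a v" for a :: "'a \<Rightarrow> int"
    proof -
      have "verts G \<inter> {u. u = v} = {v}" using v by blast
      then show ?thesis by simp
    qed
    have Short: "increment (network G) \<phi> (Short u) = of_bool (u = v)" for u
      by (simp add: \<phi>_def)
    have "flow_sum (arcs (network G)) f (increment (network G) \<phi>) = int (w v)"
      unfolding same start Short by (rule single)
    moreover have "flow_sum (verts G) (f \<circ> Excess) (increment (network G) \<phi> \<circ> Excess) \<le> 0"
      unfolding flow_sum_def by (rule sum_nonpos) (auto simp: \<phi>_def)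
    moreover have "flow_sum (verts G) (f \<circ> Short) (increment (network G) \<phi> \<circ> Short) = int (z v)"
      unfolding flow_sum_def comp_def Short z_def by (rule single)
    moreover have "increment (network G) \<phi> \<circ> Step = (\<lambda>s. of_bool (head (both_ways G) s = v))"
      by (simp add: fun_eq_iff \<phi>_def)
    ultimately show "int (w v) \<le> int (z v) + flow_sum (arcs G \<times> UNIV) h (\<lambda>s. of_bool (head (both_ways G) s = v))"
      unfolding flow_sum_network h_def by simp
  next
    show "S \<subseteq> verts G" by (auto simp: S_def)
  next
    fix e assume e: "e \<in> arcs G"
    then have "x (tail G e) = of_bool (tail G e \<in> S)" "x (head G e) = of_bool (head G e \<in> S)"
      using x by auto
    then show "p (tail G e, False) + of_bool (tail G e \<in> S) \<le> p (head G e, False) \<and>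
        p (head G e, False) + of_bool (head G e \<in> S) \<le> p (tail G e, False) + int k"
      using feas[of "Step (e, True)"] feas[of "Step (e, False)"] e by (auto simp: x_def)
  next
    have "flow_sum (arcs (network G)) f (link_cost k) =
        int k * flow_sum (arcs G \<times> UNIV) h (\<lambda>s. of_bool (snd s)) + (\<Sum>v\<in>verts G. int (z v))"
      unfolding flow_sum_network unfolding flow_sum_def h_def z_def
      by (simp add: sum_distrib_left mult.left_commute del: sum_mult_of_bool_eq)
    moreover have "flow_sum (arcs (network G)) f0 (increment (network G) p) = (\<Sum>v\<in>verts G. int (w v) * x v)"
      unfolding start by (simp add: x_def)
    moreover have "(\<Sum>v\<in>verts G. int (w v) * x v) = (\<Sum>v\<in>S. int (w v))"
    proof -
      have "(\<Sum>v\<in>verts G. int (w v) * x v) = (\<Sum>v\<in>verts G. of_bool (v \<in> S) * int (w v))"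
        by (rule sum.cong) (auto simp: x)
      also have "\<dots> = (\<Sum>v\<in>S. int (w v))"
        by (subst sum_of_bool_mult_eq) (auto simp: S_def intro!: sum.cong)
      finally show ?thesis .
    qed
    ultimately show "int k * flow_sum (arcs G \<times> UNIV) h (\<lambda>s. of_bool (snd s)) + (\<Sum>v\<in>verts G. int (z v)) =
        (\<Sum>v\<in>S. int (w v))"
      using tight by simp
  qed
qed

section \<open>Circulations as sums of circuits\<close>

lemma (in fin_digraph) finite_circuits: "finite (circuits G)"
proof -
  have "circuits G \<subseteq> (\<lambda>(V, A). \<lparr>verts = V, arcs = A, tail = tail G, head = head G\<rparr>) `
      (Pow (verts G) \<times> Pow (arcs G))"
  proof
    fix C assume "C \<in> circuits G"
    then have "verts C \<in> Pow (verts G)" "arcs C \<in> Pow (arcs G)" "tail C = tail G" "head C = head G"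
      by (auto simp: circuits_def subgraph_def compatible_def)
    then show "C \<in> (\<lambda>(V, A). \<lparr>verts = V, arcs = A, tail = tail G, head = head G\<rparr>) `
        (Pow (verts G) \<times> Pow (arcs G))"
      by (intro image_eqI[of _ _ "(verts C, arcs C)"]) auto
  qed
  then show ?thesis by (rule finite_subset) simp
qed

lemma flow_sum_remove:
  assumes "finite A" "X \<subseteq> A" "\<forall>s\<in>X. 0 < h s"
  shows "flow_sum A h \<psi> = flow_sum A (\<lambda>s. h s - of_bool (s \<in> X)) \<psi> + sum \<psi> X"
proof -
  have "int (h s) * \<psi> s = int (h s - of_bool (s \<in> X)) * \<psi> s + of_bool (s \<in> X) * \<psi> s" for s
    using assms(3) by (cases "s \<in> X") (auto simp: of_nat_diff left_diff_distrib)
  then have "flow_sum A h \<psi> = flow_sum A (\<lambda>s. h s - of_bool (s \<in> X)) \<psi> + (\<Sum>s\<in>A. of_bool (s \<in> X) * \<psi> s)"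
    unfolding flow_sum_def by (simp add: sum.distrib del: sum_of_bool_mult_eq)
  moreover have "(\<Sum>s\<in>A. of_bool (s \<in> X) * \<psi> s) = sum \<psi> X"
    using assms(1,2) by (simp add: Int_absorb1 Int_commute)
  ultimately show ?thesis by simp
qed

text \<open>Putting one more circuit into \<open>y\<close> acts on the shortages as lowering the weights on its nodes by 1.
  For nodes of weight 0 the lowered weight is truncated, hence an inequality.\<close>

lemma (in fin_digraph) circuit_cost_add_circuit:
  assumes C: "C \<in> circuits G"
  shows "circuit_cost G k w (\<lambda>B. y B + of_bool (B = C)) \<le>
    circuit_cost G k (\<lambda>v. w v - of_bool (v \<in> verts C)) y + int k * int (eta C)"
proof -
  have single: "(\<Sum>B\<in>circuits G. of_bool (B = C) * a B) = a C" for a :: "('a,'b) pre_digraph \<Rightarrow> int"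
  proof -
    have "circuits G \<inter> {B. B = C} = {C}" using C by blast
    then show ?thesis using finite_circuits by simp
  qed
  have eta_sum: "(\<Sum>B\<in>circuits G. int (y B + of_bool (B = C)) * int (eta B)) =
      (\<Sum>B\<in>circuits G. int (y B) * int (eta B)) + int (eta C)"
    by (simp add: distrib_right sum.distrib single del: sum_of_bool_mult_eq)
  let ?f = "\<lambda>v. max (int (w v) - (\<Sum>B\<in>{B \<in> circuits G. v \<in> verts B}. int (y B + of_bool (B = C)))) 0"
  let ?g = "\<lambda>v. max (int (w v - of_bool (v \<in> verts C)) - (\<Sum>B\<in>{B \<in> circuits G. v \<in> verts B}. int (y B))) 0"
  have nodes: "?f v \<le> ?g v" for v
  proof -
    have "(\<Sum>B\<in>{B \<in> circuits G. v \<in> verts B}. of_bool (B = C) :: int) = of_bool (v \<in> verts C)"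
    proof -
      have "{B \<in> circuits G. v \<in> verts B} \<inter> {B. B = C} = (if v \<in> verts C then {C} else {})"
        using C by auto
      then show ?thesis using finite_circuits by simp
    qed
    then have "(\<Sum>B\<in>{B \<in> circuits G. v \<in> verts B}. int (y B + of_bool (B = C))) =
        (\<Sum>B\<in>{B \<in> circuits G. v \<in> verts B}. int (y B)) + of_bool (v \<in> verts C)"
      by (simp add: sum.distrib del: sum_of_bool_eq)
    moreover have "0 \<le> (\<Sum>B\<in>{B \<in> circuits G. v \<in> verts B}. int (y B))" by (rule sum_nonneg) simp
    ultimately show ?thesis by (cases "w v = 0") (auto simp: of_nat_diff of_bool_def)
  qed
  show ?thesis
    unfolding circuit_cost_def eta_sum distrib_left 
    using sum_mono[where K = "verts G" and f = ?f and g = ?g, OF nodes] by linarith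
qed

text \<open>Induction on the total flow. If some arc carries flow in both directions, one unit is removed in
  each of them; this saves \<open>k \<ge> 2\<close> and raises \<open>z\<close> by 1 at each end of the arc. Otherwise a simple cycle in
  the support uses no arc twice, so it traverses a circuit \<open>C\<close>; it is removed together with one unit of
  weight on each node of \<open>C\<close>, and \<open>C\<close> is added to \<open>y\<close>.\<close>

lemma (in fin_digraph) circulation_to_circuits:
  assumes k: "2 \<le> k"
    and circ: "\<And>\<phi>. flow_sum (arcs G \<times> UNIV) h (increment (both_ways G) \<phi>) = 0"
    and cover: "\<And>v. v \<in> verts G \<Longrightarrow>
       int (w v) \<le> int (z v) + flow_sum (arcs G \<times> UNIV) h (\<lambda>s. of_bool (head (both_ways G) s = v))"
  shows "\<exists>y. circuit_cost G k w y \<le>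
     int k * flow_sum (arcs G \<times> UNIV) h (\<lambda>s. of_bool (snd s)) + (\<Sum>v\<in>verts G. int (z v))"
  using circ cover
proof (induction "\<Sum>s\<in>arcs G \<times> UNIV. h s" arbitrary: h w z rule: less_induct)
  case less
  interpret B: fin_digraph "both_ways G" by (rule fin_digraph_both_ways)
  let ?A = "arcs G \<times> (UNIV :: bool set)"
  let ?in = "\<lambda>h v. flow_sum ?A h (\<lambda>s. of_bool (head (both_ways G) s = v))"
  have finA: "finite ?A" by simp
  \<comment> \<open>Removing one unit of flow from each step of a closed set of used steps.\<close>
  define rest where "rest X = (\<lambda>s. h s - of_bool (s \<in> X))" for X :: "('b \<times> bool) set"
  have rest: "flow_sum ?A h \<psi> = flow_sum ?A (rest X) \<psi> + sum \<psi> X"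
    "(\<Sum>s\<in>?A. rest X s) < (\<Sum>s\<in>?A. h s)"
    if X: "X \<noteq> {}" "X \<subseteq> ?A" "\<forall>s\<in>X. 0 < h s" for X \<psi>
  proof -
    show "flow_sum ?A h \<psi> = flow_sum ?A (rest X) \<psi> + sum \<psi> X"
      unfolding rest_def by (rule flow_sum_remove[OF finA X(2,3)])
    obtain s where "s \<in> X" using X(1) by blast
    then show "(\<Sum>s\<in>?A. rest X s) < (\<Sum>s\<in>?A. h s)"
      by (intro sum_strict_mono_ex1 finA ballI bexI[of _ s]) (use X in \<open>auto simp: rest_def\<close>)
  qed
  show ?case
  proof (cases "\<exists>e\<in>arcs G. 0 < h (e, True) \<and> 0 < h (e, False)")
    case True
    then obtain e where e: "e \<in> arcs G" "0 < h (e, True)" "0 < h (e, False)" by blast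
    let ?X = "{(e, True), (e, False)}"
    let ?z = "\<lambda>v. z v + of_bool (head G e = v) + of_bool (tail G e = v)"
    have X: "?X \<noteq> {}" "?X \<subseteq> ?A" "\<forall>s\<in>?X. 0 < h s" using e by auto
    have R: "flow_sum ?A h \<psi> = flow_sum ?A (rest ?X) \<psi> + (\<psi> (e, True) + \<psi> (e, False))" for \<psi>
      using rest(1)[OF X, of \<psi>] by simp
    have "\<exists>y. circuit_cost G k w y \<le>
        int k * flow_sum ?A (rest ?X) (\<lambda>s. of_bool (snd s)) + (\<Sum>v\<in>verts G. int (?z v))"
    proof (rule less.hyps[OF rest(2)[OF X]])
      show "flow_sum ?A (rest ?X) (increment (both_ways G) \<phi>) = 0" for \<phi>
        using less.prems(1)[of \<phi>] R[of "increment (both_ways G) \<phi>"] by simp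
      show "int (w v) \<le> int (?z v) + ?in (rest ?X) v" if "v \<in> verts G" for v
      proof -
        have "?in h v = ?in (rest ?X) v + (of_bool (head G e = v) + of_bool (tail G e = v))"
          using R[of "\<lambda>s. of_bool (head (both_ways G) s = v)"]
          by (simp only: both_ways_simps fst_conv snd_conv if_True if_False)
        then show ?thesis using less.prems(2)[OF that] by (simp only: of_nat_add of_nat_of_bool add_ac)
      qed
    qed
    then obtain y where y: "circuit_cost G k w y \<le>
        int k * flow_sum ?A (rest ?X) (\<lambda>s. of_bool (snd s)) + (\<Sum>v\<in>verts G. int (?z v))" by blast
    have z_sum: "(\<Sum>v\<in>verts G. int (?z v)) = (\<Sum>v\<in>verts G. int (z v)) + 2"
    proof -
      have "verts G \<inter> {v. u = v} = {u}" if "u \<in> verts G" for u using that by blast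
      then show ?thesis using e(1) by (simp add: sum.distrib)
    qed
    have "int k * flow_sum ?A h (\<lambda>s. of_bool (snd s)) =
        int k * flow_sum ?A (rest ?X) (\<lambda>s. of_bool (snd s)) + int k"
      using R[of "\<lambda>s. of_bool (snd s)"] by (simp add: distrib_left)
    then show ?thesis using y k unfolding z_sum by (intro exI[of _ y]) linarith
  next
    case no_back: False
    show ?thesis
    proof (cases "\<exists>s\<in>?A. 0 < h s")
      case True
      let ?R = "{s \<in> ?A. 0 < h s}"
      have succ: "\<exists>s'\<in>?R. tail (both_ways G) s' = head (both_ways G) s" if s: "s \<in> ?R" for s
      proof (rule ccontr)
        \<comment> \<open>Conservation at the head of the step fails if no step out of it carries flow.\<close>
        assume none: "\<not> ?thesis"
        let ?v = "head (both_ways G) s"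
        define \<phi> where "\<phi> u = (of_bool (u = ?v) :: int)" for u
        have "int (h t) * increment (both_ways G) \<phi> t = int (h t) * of_bool (head (both_ways G) t = ?v)"
          if "t \<in> ?A" for t
        proof (cases "h t = 0")
          case False
          then have "tail (both_ways G) t \<noteq> ?v" using none that by blast
          then show ?thesis by (simp only: \<phi>_def of_bool_eq diff_zero simp_thms)
        qed simp
        then have "flow_sum ?A h (increment (both_ways G) \<phi>) =
            (\<Sum>t\<in>?A. int (h t) * of_bool (head (both_ways G) t = ?v))"
          unfolding flow_sum_def by (rule sum.cong[OF refl])
        moreover have "0 < (\<Sum>t\<in>?A. int (h t) * of_bool (head (both_ways G) t = ?v))"
          by (rule sum_pos2[OF finA, of s]) (use s in auto)
        ultimately show False using less.prems(1)[of \<phi>] by simp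
      qed
      obtain p where p: "B.cycle p" "set p \<subseteq> ?R"
      proof (rule B.cycle_from_successors[of ?R "\<lambda>_ _. True"])
        show "?R \<subseteq> arcs (both_ways G)" by auto
        show "?R \<noteq> {}" using True by blast
        show "\<exists>s'\<in>?R. tail (both_ways G) s' = head (both_ways G) s \<and> True" if "s \<in> ?R" for s
          using succ[OF that] by (simp only: simp_thms)
      qed (rule that)
      have X: "set p \<noteq> {}" "set p \<subseteq> ?A" "\<forall>s\<in>set p. 0 < h s"
      proof -
        show "set p \<noteq> {}" using p(1) unfolding B.cycle_iff_rotate set_empty by blast
        show "set p \<subseteq> ?A" using p(2) by blast
        show "\<forall>s\<in>set p. 0 < h s" using p(2) by blast
      qed
      note R = rest(1)[OF X]
      have "inj_on fst (set p)"
      proof (rule inj_onI, rule ccontr)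
        fix r s assume rs: "r \<in> set p" "s \<in> set p" "fst r = fst s" "r \<noteq> s"
        have "{(fst r, True), (fst r, False)} = {r, s}" using rs(3,4) by (cases r; cases s) auto
        then have "{(fst r, True), (fst r, False)} \<subseteq> set p" using rs(1,2) by simp
        then have "0 < h (fst r, True)" "0 < h (fst r, False)" using X(3) by auto
        moreover have "fst r \<in> arcs G" using subsetD[OF X(2) rs(1)] by auto
        ultimately show False using no_back by blast
      qed
      then have dist: "distinct (map fst p)" using B.cycle_distinct[OF p(1)] by (simp add: distinct_map)
      define C where "C = traced G p"
      have C: "C \<in> circuits G" "traversal C p"
        unfolding C_def by (rule cycle_traces_circuit[OF p(1) dist])+
      have "wf_digraph C" using C(1) by (auto simp: circuits_def subgraph_def)
      then have eta: "int (eta C) \<le> (\<Sum>s\<in>set p. of_bool (snd s))"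
        using wf_digraph.eta_eq_min_counts[OF _ C(2)] forward_count_eq_card[OF B.cycle_distinct[OF p(1)]]
        by (simp add: Int_def)
      have once: "(\<Sum>s\<in>set p. of_bool (head (both_ways G) s = v)) = (of_bool (v \<in> verts C) :: int)" for v
      proof -
        have "(\<Sum>s\<in>set p. of_bool (head (both_ways G) s = v)) =
            (\<Sum>u\<in>head (both_ways G) ` set p. of_bool (u = v) :: int)"
          unfolding sum.reindex[OF B.cycle_inj_on_head[OF p(1)]] comp_def ..
        also have "head (both_ways G) ` set p = verts C"
          unfolding C_def traced_simps by (rule B.cycle_head_image[OF p(1)])
        also have "(\<Sum>u\<in>verts C. of_bool (u = v) :: int) = of_bool (v \<in> verts C)"
        proof -
          have "verts C \<inter> {u. u = v} = (if v \<in> verts C then {v} else {})" by auto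
          moreover have "finite (verts C)" by (simp add: C_def)
          ultimately show ?thesis by simp
        qed
        finally show ?thesis .
      qed
      let ?w = "\<lambda>v. w v - of_bool (v \<in> verts C)"
      have "\<exists>y. circuit_cost G k ?w y \<le>
          int k * flow_sum ?A (rest (set p)) (\<lambda>s. of_bool (snd s)) + (\<Sum>v\<in>verts G. int (z v))"
      proof (rule less.hyps[OF rest(2)[OF X]])
        show "flow_sum ?A (rest (set p)) (increment (both_ways G) \<phi>) = 0" for \<phi>
          using less.prems(1)[of \<phi>] R[of "increment (both_ways G) \<phi>"]
            B.cycle_sum_head_eq_tail[OF p(1), of \<phi>] unfolding sum_subtractf by linarith
        show "int (?w v) \<le> int (z v) + ?in (rest (set p)) v" if v: "v \<in> verts G" for v
        proof -
          have "0 \<le> ?in (rest (set p)) v" by (rule flow_sum_nonneg) simp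
          moreover have "?in h v = ?in (rest (set p)) v + of_bool (v \<in> verts C)"
            by (rule trans[OF R]) (simp only: once)
          ultimately show ?thesis using less.prems(2)[OF v] by (cases "v \<in> verts C"; cases "w v") simp_all
        qed
      qed
      then obtain y where y: "circuit_cost G k ?w y \<le>
          int k * flow_sum ?A (rest (set p)) (\<lambda>s. of_bool (snd s)) + (\<Sum>v\<in>verts G. int (z v))" by blast
      have "circuit_cost G k w (\<lambda>B. y B + of_bool (B = C)) \<le> circuit_cost G k ?w y + int k * int (eta C)"
        by (rule circuit_cost_add_circuit[OF C(1)])
      also have "\<dots> \<le> int k * flow_sum ?A (rest (set p)) (\<lambda>s. of_bool (snd s)) + (\<Sum>v\<in>verts G. int (z v))
          + int k * (\<Sum>s\<in>set p. of_bool (snd s))"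
        using y eta by (intro add_mono mult_left_mono) auto
      also have "\<dots> = int k * flow_sum ?A h (\<lambda>s. of_bool (snd s)) + (\<Sum>v\<in>verts G. int (z v))"
        unfolding R[of "\<lambda>s. of_bool (snd s)"] by (simp only: distrib_left add_ac)
      finally show ?thesis by blast
    next
      case False
      then have zero: "flow_sum ?A h \<psi> = 0" for \<psi> unfolding flow_sum_def by (intro sum.neutral) auto
      have "circuit_cost G k w (\<lambda>_. 0) = (\<Sum>v\<in>verts G. int (w v))" by (simp add: circuit_cost_def)
      also have "\<dots> \<le> (\<Sum>v\<in>verts G. int (z v))"
        using less.prems(2) unfolding zero by (intro sum_mono) simp
      finally show ?thesis unfolding zero by (intro exI[of _ "\<lambda>_. 0"]) simp
    qed
  qed
qed

section \<open>Duality\<close>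

lemma (in fin_digraph) strong_duality:
  fixes w :: "'a \<Rightarrow> nat"
  assumes k: "2 \<le> k"
  obtains S y where "S \<subseteq> verts G" "k_sink_stable G k S" "circuit_cost G k w y \<le> (\<Sum>v\<in>S. int (w v))"
proof -
  obtain h z S and \<pi> :: "'a \<Rightarrow> int" where
    circ: "\<And>\<phi>. flow_sum (arcs G \<times> UNIV) h (increment (both_ways G) \<phi>) = 0"
    and cover: "\<And>v. v \<in> verts G \<Longrightarrow>
       int (w v) \<le> int (z v) + flow_sum (arcs G \<times> UNIV) h (\<lambda>s. of_bool (head (both_ways G) s = v))"
    and S: "S \<subseteq> verts G"
    and pot: "\<And>e. e \<in> arcs G \<Longrightarrow> \<pi> (tail G e) + of_bool (tail G e \<in> S) \<le> \<pi> (head G e) \<and>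
       \<pi> (head G e) + of_bool (head G e \<in> S) \<le> \<pi> (tail G e) + int k"
    and cost: "int k * flow_sum (arcs G \<times> UNIV) h (\<lambda>s. of_bool (snd s)) + (\<Sum>v\<in>verts G. int (z v)) =
       (\<Sum>v\<in>S. int (w v))"
  proof (rule optimal_circulation[of w k])
  qed (rule that)
  have "k_sink_stable G k S" by (rule k_sink_stableI_potential[OF _ S pot]) (use k in auto)
  moreover obtain y where "circuit_cost G k w y \<le>
     int k * flow_sum (arcs G \<times> UNIV) h (\<lambda>s. of_bool (snd s)) + (\<Sum>v\<in>verts G. int (z v))"
    using circulation_to_circuits[OF k circ cover] by blast
  ultimately show ?thesis using that[OF S] cost by simp
qed

text \<open>Each unit of weight in \<open>S\<close> is charged to a circuit through its node or to the shortage of \<open>y\<close> there;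
  a circuit is charged at most \<open>card (S \<inter> verts C)\<close> times its multiplicity.\<close>

lemma (in fin_digraph) weak_duality:
  fixes w :: "'a \<Rightarrow> nat"
  assumes S: "S \<subseteq> verts G" and circ: "\<And>C. C \<in> circuits G \<Longrightarrow> card (S \<inter> verts C) \<le> k * eta C"
  shows "(\<Sum>v\<in>S. int (w v)) \<le> circuit_cost G k w y"
proof -
  let ?load = "\<lambda>v. \<Sum>C\<in>{C \<in> circuits G. v \<in> verts C}. int (y C)"
  have finS: "finite S" by (rule finite_subset[OF S finite_verts])
  have "(\<Sum>v\<in>S. int (w v)) \<le> (\<Sum>v\<in>S. ?load v + max (int (w v) - ?load v) 0)"
    by (rule sum_mono) simp
  also have "\<dots> = (\<Sum>v\<in>S. ?load v) + (\<Sum>v\<in>S. max (int (w v) - ?load v) 0)" by (rule sum.distrib)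
  also have "(\<Sum>v\<in>S. max (int (w v) - ?load v) 0) \<le> (\<Sum>v\<in>verts G. max (int (w v) - ?load v) 0)"
    by (rule sum_mono2) (use S in auto)
  also have "(\<Sum>v\<in>S. ?load v) = (\<Sum>C\<in>circuits G. \<Sum>v\<in>{v \<in> S. v \<in> verts C}. int (y C))"
    by (rule sum.swap_restrict[OF finS finite_circuits])
  also have "\<dots> = (\<Sum>C\<in>circuits G. int (y C) * int (card (S \<inter> verts C)))"
    by (simp add: Int_def mult.commute)
  also have "\<dots> \<le> (\<Sum>C\<in>circuits G. int (y C) * (int k * int (eta C)))"
    by (rule sum_mono, rule mult_left_mono) (use circ in \<open>auto simp flip: of_nat_mult\<close>)
  also have "\<dots> = int k * (\<Sum>C\<in>circuits G. int (y C) * int (eta C))"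
    by (simp add: sum_distrib_left mult.left_commute)
  finally show ?thesis by (simp add: circuit_cost_def)
qed

section \<open>Total dual integrality\<close>

lemma finite_system_rows:
  assumes "fin_digraph D"
  shows "finite (system_rows D)"
  unfolding system_rows_def
  using fin_digraph.finite_circuits[OF assms] fin_digraph.finite_verts[OF assms] by simp

lemma sum_system_rows:
  assumes "fin_digraph D"
  shows "(\<Sum>i\<in>system_rows D. g i) = (\<Sum>C\<in>circuits D. g (Circuit_Row C)) +
     (\<Sum>u\<in>verts D. g (Upper_Row u)) + (\<Sum>u\<in>verts D. g (Lower_Row u))"
proof -
  have fin: "finite (circuits D)" "finite (verts D)"
    using fin_digraph.finite_circuits[OF assms] fin_digraph.finite_verts[OF assms] by auto
  have "(\<Sum>i\<in>system_rows D. g i) = sum g (Circuit_Row ` circuits D) +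
      sum g (Upper_Row ` verts D) + sum g (Lower_Row ` verts D)"
    unfolding system_rows_def using fin by (subst sum.union_disjoint; auto)+
  then show ?thesis by (simp add: sum.reindex inj_on_def)
qed

lemma lp_weak_duality:
  assumes "finite I" "x \<in> primal_feasible I J M b" "y \<in> dual_feasible I J M c"
  shows "(\<Sum>j\<in>J. c j * x j) \<le> (\<Sum>i\<in>I. y i * b i)"
proof -
  have "(\<Sum>j\<in>J. c j * x j) = (\<Sum>j\<in>J. \<Sum>i\<in>I. y i * M i j * x j)"
    by (rule sum.cong) (use assms(3) in \<open>auto simp: dual_feasible_def simp flip: sum_distrib_right\<close>)
  also have "\<dots> = (\<Sum>i\<in>I. y i * (\<Sum>j\<in>J. M i j * x j))"
    by (subst sum.swap) (simp add: sum_distrib_left mult.assoc)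
  also have "\<dots> \<le> (\<Sum>i\<in>I. y i * b i)"
    by (intro sum_mono mult_left_mono) (use assms(2,3) in \<open>auto simp: primal_feasible_def dual_feasible_def\<close>)
  finally show ?thesis .
qed

lemma (in fin_digraph) indicator_primal_feasible:
  assumes S: "S \<subseteq> verts G" and circ: "\<And>C. C \<in> circuits G \<Longrightarrow> card (S \<inter> verts C) \<le> k * eta C"
  shows "(\<lambda>v. of_bool (v \<in> S)) \<in> primal_feasible (system_rows G) (verts G) system_matrix (system_rhs k)"
  unfolding primal_feasible_def
proof (intro CollectI ballI)
  fix i assume "i \<in> system_rows G"
  then consider C where "i = Circuit_Row C" "C \<in> circuits G" | u where "i = Upper_Row u" "u \<in> verts G"
    | u where "i = Lower_Row u" "u \<in> verts G"
    by (auto simp: system_rows_def)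
  then show "(\<Sum>j\<in>verts G. system_matrix i j * of_bool (j \<in> S)) \<le> system_rhs k i"
  proof cases
    case 1
    have "(\<Sum>j\<in>verts G. system_matrix i j * of_bool (j \<in> S)) = (\<Sum>j\<in>verts G. of_bool (j \<in> S \<inter> verts C))"
      unfolding 1 by (rule sum.cong) (auto simp: incidence_Q_def)
    also have "\<dots> = real (card (verts G \<inter> {j. j \<in> S \<inter> verts C}))" by simp
    also have "verts G \<inter> {j. j \<in> S \<inter> verts C} = S \<inter> verts C" using S by blast
    also have "real (card (S \<inter> verts C)) \<le> real (k * eta C)" using circ[OF 1(2)] by (simp only: of_nat_le_iff)
    finally show ?thesis unfolding 1 by simp
  next
    case 2
    have "(\<Sum>j\<in>verts G. system_matrix i j * of_bool (j \<in> S)) = (\<Sum>j\<in>verts G. if u = j then of_bool (u \<in> S) else 0)"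
      unfolding 2 by (rule sum.cong) auto
    then show ?thesis using 2 by simp
  next
    case 3
    have "(\<Sum>j\<in>verts G. system_matrix i j * of_bool (j \<in> S)) = (\<Sum>j\<in>verts G. if u = j then - of_bool (u \<in> S) else 0)"
      unfolding 3 by (rule sum.cong) auto
    then show ?thesis using 3 by simp
  qed
qed

text \<open>For an integral objective \<open>c\<close>, an optimal dual solution comes from the min-max formula for the
  nonnegative part of \<open>c\<close>: the circuit rows receive the multiplicities \<open>y\<close>, the rows \<open>x v \<le> 1\<close> the
  shortage at \<open>v\<close> and the rows \<open>- x v \<le> 0\<close> the surplus over \<open>c v\<close>. Nodes of negative objective may be
  dropped from the optimal set without losing feasibility, which gives a primal solution of the same
  value.\<close>

lemma (in fin_digraph) system_totally_dual_integral:
  assumes k: "2 \<le> k"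
  shows "totally_dual_integral (system_rows G) (verts G) system_matrix (system_rhs k)"
  unfolding totally_dual_integral_def
proof (intro allI impI)
  fix c :: "'a \<Rightarrow> int"
  let ?I = "system_rows G" and ?V = "verts G"
  let ?c = "\<lambda>v. real_of_int (c v)"
  define w where "w v = nat (c v)" for v
  obtain S y where S: "S \<subseteq> ?V" "k_sink_stable G k S"
    and le: "circuit_cost G k w y \<le> (\<Sum>v\<in>S. int (w v))"
    by (rule strong_duality[OF k, of w])
  define load where "load v = (\<Sum>C\<in>{C \<in> circuits G. v \<in> verts C}. int (y C))" for v
  define z where "z v = max (int (w v) - load v) 0" for v
  define d where "d i = (case i of Circuit_Row C \<Rightarrow> real (y C) | Upper_Row u \<Rightarrow> of_int (z u)
      | Lower_Row u \<Rightarrow> of_int (load u + z u - c u))" for i :: "('a,'b) row"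
  have d_simps: "d (Circuit_Row C) = real (y C)" "d (Upper_Row u) = of_int (z u)"
    "d (Lower_Row u) = of_int (load u + z u - c u)" for C u
    by (simp_all add: d_def)
  note split = sum_system_rows[OF fin_digraph]
  have dual: "d \<in> dual_feasible ?I ?V system_matrix ?c"
    unfolding dual_feasible_def
  proof (intro CollectI conjI ballI)
    fix i assume "i \<in> ?I"
    show "0 \<le> d i"
      by (cases i) (auto simp: d_simps z_def w_def)
  next
    fix v assume v: "v \<in> ?V"
    have "(\<Sum>C\<in>circuits G. d (Circuit_Row C) * system_matrix (Circuit_Row C) v) = of_int (load v)"
    proof -
      have "(\<Sum>C\<in>circuits G. d (Circuit_Row C) * system_matrix (Circuit_Row C) v) =
          (\<Sum>C\<in>circuits G. if v \<in> verts C then real (y C) else 0)"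
        by (rule sum.cong) (auto simp: d_simps incidence_Q_def)
      then show ?thesis
        using finite_circuits by (auto simp: load_def sum.inter_filter intro!: sum.cong)
    qed
    moreover have "(\<Sum>u\<in>?V. d (Upper_Row u) * system_matrix (Upper_Row u) v) = of_int (z v)"
    proof -
      have "(\<Sum>u\<in>?V. d (Upper_Row u) * system_matrix (Upper_Row u) v) =
          (\<Sum>u\<in>?V. if u = v then of_int (z v) else 0)"
        by (rule sum.cong) (auto simp: d_simps)
      then show ?thesis using v by simp
    qed
    moreover have "(\<Sum>u\<in>?V. d (Lower_Row u) * system_matrix (Lower_Row u) v) = - of_int (load v + z v - c v)"
    proof -
      have "(\<Sum>u\<in>?V. d (Lower_Row u) * system_matrix (Lower_Row u) v) =
          (\<Sum>u\<in>?V. if u = v then - of_int (load v + z v - c v) else 0)"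
        by (rule sum.cong) (auto simp: d_simps)
      then show ?thesis using v by simp
    qed
    ultimately show "(\<Sum>i\<in>?I. d i * system_matrix i v) = ?c v" unfolding split by simp
  qed
  have int: "\<forall>i\<in>?I. d i \<in> \<int>"
  proof
    fix i show "d i \<in> \<int>" by (cases i) (simp_all only: d_simps Ints_of_int Ints_of_nat)
  qed
  have value_d: "(\<Sum>i\<in>?I. d i * system_rhs k i) = of_int (circuit_cost G k w y)"
    unfolding split circuit_cost_def
    by (simp add: d_simps z_def load_def sum_distrib_left mult_ac)
  define T where "T = {v \<in> S. 0 \<le> c v}"
  have "card (T \<inter> verts C) \<le> k * eta C" if C: "C \<in> circuits G" for C
  proof -
    have "finite (S \<inter> verts C)" using S(1) finite_subset[OF _ finite_verts] by blast
    then have "card (T \<inter> verts C) \<le> card (S \<inter> verts C)" by (rule card_mono) (auto simp: T_def)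
    also have "\<dots> \<le> k * eta C" by (rule k_sink_stable_card_circuit_le[OF C S(2)])
    finally show ?thesis .
  qed
  then have primal: "(\<lambda>v. of_bool (v \<in> T)) \<in> primal_feasible ?I ?V system_matrix (system_rhs k)"
    by (intro indicator_primal_feasible) (use S(1) in \<open>auto simp: T_def\<close>)
  have value_T: "(\<Sum>v\<in>?V. ?c v * of_bool (v \<in> T)) = of_int (\<Sum>v\<in>S. int (w v))"
  proof -
    have "(\<Sum>v\<in>?V. ?c v * of_bool (v \<in> T)) = (\<Sum>v\<in>?V. if v \<in> S then real (w v) else 0)"
      by (rule sum.cong) (auto simp: T_def w_def)
    also have "\<dots> = (\<Sum>v\<in>?V \<inter> S. real (w v))" by (simp add: sum.inter_restrict)
    also have "?V \<inter> S = S" using S(1) by blast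
    finally show ?thesis by simp
  qed
  have "(\<Sum>i\<in>?I. d i * system_rhs k i) \<le> (\<Sum>i\<in>?I. d' i * system_rhs k i)"
    if "d' \<in> dual_feasible ?I ?V system_matrix ?c" for d'
  proof -
    have "(\<Sum>i\<in>?I. d i * system_rhs k i) \<le> (\<Sum>v\<in>?V. ?c v * of_bool (v \<in> T))"
      unfolding value_d value_T using le by (simp only: of_int_le_iff)
    also have "\<dots> \<le> (\<Sum>i\<in>?I. d' i * system_rhs k i)"
      by (rule lp_weak_duality[OF finite_system_rows[OF fin_digraph] primal that])
    finally show ?thesis .
  qed
  then show "\<exists>d\<in>dual_feasible ?I ?V system_matrix ?c. (\<forall>i\<in>?I. d i \<in> \<int>) \<and>
      (\<forall>d'\<in>dual_feasible ?I ?V system_matrix ?c.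
        (\<Sum>i\<in>?I. d i * system_rhs k i) \<le> (\<Sum>i\<in>?I. d' i * system_rhs k i))"
    using dual int by blast
qed

theorem theorem6p5:
  fixes D :: "('a,'b) pre_digraph" and k :: nat and w :: "'a \<Rightarrow> nat"
  assumes "fin_digraph D"
    and "no_isolated_nodes D"
    and "k \<ge> 2"
  shows "(\<exists>m. is_maximum (stable_weights D k w) m \<and>
              is_minimum (range (circuit_cost D k w)) m) \<and>
         totally_dual_integral (system_rows D) (verts D) system_matrix (system_rhs k)"
proof
  interpret fin_digraph D by fact
  have weak: "(\<Sum>v\<in>T. int (w v)) \<le> circuit_cost D k w y" if "T \<subseteq> verts D" "k_sink_stable D k T" for T y
    using weak_duality[OF that(1) k_sink_stable_card_circuit_le[OF _ that(2)]] .
  obtain S y where S: "S \<subseteq> verts D" "k_sink_stable D k S"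
    and le: "circuit_cost D k w y \<le> (\<Sum>v\<in>S. int (w v))"
    by (rule strong_duality[OF \<open>k \<ge> 2\<close>, of w])
  have eq: "circuit_cost D k w y = (\<Sum>v\<in>S. int (w v))" using le weak[OF S, of y] by simp
  have "is_maximum (stable_weights D k w) (\<Sum>v\<in>S. int (w v))"
    unfolding is_maximum_def stable_weights_def using S weak[of _ y] unfolding eq by blast
  moreover have "is_minimum (range (circuit_cost D k w)) (\<Sum>v\<in>S. int (w v))"
    unfolding is_minimum_def using weak[OF S] eq by (metis rangeE rangeI)
  ultimately show "\<exists>m. is_maximum (stable_weights D k w) m \<and> is_minimum (range (circuit_cost D k w)) m"
    by blast
  show "totally_dual_integral (system_rows D) (verts D) system_matrix (system_rhs k)"
    by (rule system_totally_dual_integral) fact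
qed

end
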